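(* Let $\rho$ be a strongly invariant probability measure for $r$. Let $m_0\in L^\infty(X,\rho)$ satisfy $$\frac{1}{\#r^{-1}(x)}\sum_{y\in r^{-1}(x)}|m_0(y)|^2=1\quad(x\in X),$$ and let $h\in L^\infty(X,\rho)$ be a function with $h\ge0$ and $$\frac{1}{\#r^{-1}(x)}\sum_{r(y)=x}|m_0(y)|^2h(y)=h(x)\quad(x\in X).$$ Then the operator $S_0$ on $L^2(X,h\,d\rho)$ defined by $S_0f=m_0\cdot(f\circ r)$ is an isometry. Assume in addition that $r$ is averaging with respect to $\rho$ and that $|m_0|\ne1$ on a set of positive $\rho$-measure. Then $$\bigcap_{k\ge1}S_0^k\big(L^2(X,h\,d\rho)\big)=\{0\}.$$
   Context: $X$ is a compact metric space with Borel $\sigma$-algebra $\mathfrak B$; $r:X\to X$ is a non-invertible measurable onto map with $0<\#r^{-1}(x)<\infty$ for all $x\in X$. A Borel probability measure $\rho$ on $X$ is strongly invariant if $\int_X f\,d\rho=\int_X\frac{1}{\#r^{-1}(x)}\sum_{y\in r^{-1}(x)}f(y)\,d\rho(x)$ for all $f\in L^\infty(\rho)$. Let $\mathfrak B_\infty:=\bigcap_{n\ge1}r^{-n}(\mathfrak B)$. The map $r$ is averaging with respect to $\rho$ if $L^1(\mathfrak B_\infty,\rho)$ contains only functions that are constant $\rho$-a.e. (equivalently, $\mathfrak B_\infty$ contains only sets of $\rho$-measure $0$ or $1$). *)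

theory Defs
  imports "HOL-Probability.Probability"
begin

section \<open>Fibre averages and strongly invariant measures\<close>

definition fibre_avg :: "('a \<Rightarrow> 'a) \<Rightarrow> ('a \<Rightarrow> 'b::real_vector) \<Rightarrow> 'a \<Rightarrow> 'b" where
  "fibre_avg r f x = (1 / real (card (r -` {x}))) *\<^sub>R (\<Sum>y\<in>r -` {x}. f y)"

text \<open>Elements of \<open>L\<^sup>\<infinity>\<close> are given by measurable, essentially bounded representatives.\<close>

definition L_infinity :: "'a measure \<Rightarrow> ('a \<Rightarrow> 'b::real_normed_vector) set" where
  "L_infinity M = {f \<in> borel_measurable M. \<exists>B. AE x in M. norm (f x) \<le> B}"

text \<open>
  The integral on the right presupposes that the fibre average is integrable; since the
  Bochner integral of a non-integrable function is \<open>0\<close> in HOL, this is stated explicitly.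
\<close>

definition strongly_invariant :: "'a measure \<Rightarrow> ('a \<Rightarrow> 'a) \<Rightarrow> bool" where
  "strongly_invariant \<rho> r \<longleftrightarrow>
     (\<forall>f::'a \<Rightarrow> complex. f \<in> L_infinity \<rho> \<longrightarrow>
        integrable \<rho> (fibre_avg r f) \<and>
        (\<integral>x. f x \<partial>\<rho>) = (\<integral>x. fibre_avg r f x \<partial>\<rho>))"


section \<open>Averaging maps\<close>

definition tail_algebra :: "('a::topological_space \<Rightarrow> 'a) \<Rightarrow> 'a measure" where
  "tail_algebra r = sigma UNIV (\<Inter>n\<in>{1..}. {(r ^^ n) -` A |A. A \<in> sets borel})"

text \<open>
  \<^term>\<open>restr_to_subalg \<rho> (tail_algebra r)\<close> is \<open>\<rho>\<close> restricted to the tail algebra, so its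
  integrable functions are those of \<open>L\<^sup>1\<close> over the tail algebra; in particular they are
  measurable with respect to it.
\<close>

definition averaging :: "'a::topological_space measure \<Rightarrow> ('a \<Rightarrow> 'a) \<Rightarrow> bool" where
  "averaging \<rho> r \<longleftrightarrow>
     (\<forall>f::'a \<Rightarrow> complex. integrable (restr_to_subalg \<rho> (tail_algebra r)) f \<longrightarrow>
        (\<exists>c. AE x in \<rho>. f x = c))"


section \<open>Complex \<open>L\<^sup>2\<close> as a space of classes modulo almost everywhere equality\<close>

definition L2_fun :: "'a measure \<Rightarrow> ('a \<Rightarrow> complex) set" where
  "L2_fun M = {f \<in> borel_measurable M. integrable M (\<lambda>x. (norm (f x))\<^sup>2)}"

definition L2_rel :: "'a measure \<Rightarrow> (('a \<Rightarrow> complex) \<times> ('a \<Rightarrow> complex)) set" where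
  "L2_rel M = {(f, g). f \<in> L2_fun M \<and> g \<in> L2_fun M \<and> (AE x in M. f x = g x)}"

definition L2_space :: "'a measure \<Rightarrow> ('a \<Rightarrow> complex) set set" where
  "L2_space M = L2_fun M // L2_rel M"

definition L2_class :: "'a measure \<Rightarrow> ('a \<Rightarrow> complex) \<Rightarrow> ('a \<Rightarrow> complex) set" where
  "L2_class M f = L2_rel M `` {f}"

definition L2_zero :: "'a measure \<Rightarrow> ('a \<Rightarrow> complex) set" where
  "L2_zero M = L2_class M (\<lambda>_. 0)"

definition L2_add ::
  "'a measure \<Rightarrow> ('a \<Rightarrow> complex) set \<Rightarrow> ('a \<Rightarrow> complex) set \<Rightarrow> ('a \<Rightarrow> complex) set" where
  "L2_add M C D = (\<Union>f\<in>C. \<Union>g\<in>D. L2_class M (\<lambda>x. f x + g x))"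

definition L2_scale ::
  "'a measure \<Rightarrow> complex \<Rightarrow> ('a \<Rightarrow> complex) set \<Rightarrow> ('a \<Rightarrow> complex) set" where
  "L2_scale M c C = (\<Union>f\<in>C. L2_class M (\<lambda>x. c * f x))"

definition L2_norm :: "'a measure \<Rightarrow> ('a \<Rightarrow> complex) set \<Rightarrow> real" where
  "L2_norm M C = sqrt (\<integral>x. (norm ((SOME f. f \<in> C) x))\<^sup>2 \<partial>M)"

lemma equiv_L2_rel: "equiv (L2_fun M) (L2_rel M)"
proof (rule equivI)
  show "trans (L2_rel M)"
    unfolding L2_rel_def trans_def by (auto elim: AE_mp)
qed (auto simp: L2_rel_def refl_on_def sym_def eq_commute)

lemma L2_norm_class:
  assumes "f \<in> L2_fun M"
  shows "L2_norm M (L2_class M f) = sqrt (\<integral>x. (norm (f x))\<^sup>2 \<partial>M)"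
proof -
  let ?g = "SOME g. g \<in> L2_class M f"
  have "f \<in> L2_class M f"
    using assms by (auto simp: L2_class_def L2_rel_def)
  then have "?g \<in> L2_class M f"
    by (rule someI[where P = "\<lambda>g. g \<in> L2_class M f"])
  then have g: "?g \<in> L2_fun M" "AE x in M. f x = ?g x"
    by (auto simp: L2_class_def L2_rel_def)
  have "(\<integral>x. (norm (?g x))\<^sup>2 \<partial>M) = (\<integral>x. (norm (f x))\<^sup>2 \<partial>M)"
    by (rule integral_cong_AE) (use assms g in \<open>auto simp: L2_fun_def\<close>)
  then show ?thesis
    by (simp add: L2_norm_def)
qed

definition linear_isometry_L2 ::
  "'a measure \<Rightarrow> (('a \<Rightarrow> complex) set \<Rightarrow> ('a \<Rightarrow> complex) set) \<Rightarrow> bool" where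
  "linear_isometry_L2 M T \<longleftrightarrow>
     (\<forall>C\<in>L2_space M. T C \<in> L2_space M) \<and>
     (\<forall>C\<in>L2_space M. \<forall>D\<in>L2_space M. T (L2_add M C D) = L2_add M (T C) (T D)) \<and>
     (\<forall>c. \<forall>C\<in>L2_space M. T (L2_scale M c C) = L2_scale M c (T C)) \<and>
     (\<forall>C\<in>L2_space M. L2_norm M (T C) = L2_norm M C)"


section \<open>The weighted composition operator\<close>

abbreviation weighted_measure :: "'a measure \<Rightarrow> ('a \<Rightarrow> real) \<Rightarrow> 'a measure" where
  "weighted_measure \<rho> h \<equiv> density \<rho> (\<lambda>x. ennreal (h x))"

text \<open>
  The operator induced on classes by \<open>f \<mapsto> m \<cdot> (f \<circ> r)\<close>. When \<open>m \<cdot> (f \<circ> r)\<close> is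
  square-integrable and its class does not depend on the representative \<open>f\<close>, the union is that class.
\<close>

definition S0 ::
  "'a measure \<Rightarrow> ('a \<Rightarrow> complex) \<Rightarrow> ('a \<Rightarrow> 'a) \<Rightarrow> ('a \<Rightarrow> complex) set \<Rightarrow> ('a \<Rightarrow> complex) set" where
  "S0 M m r C = (\<Union>f\<in>C. L2_class M (\<lambda>x. m x * f (r x)))"

end

theory Submission
  imports Defs
begin

text \<open>
  Write \<open>u = \<bar>f\<bar>\<^sup>2 h\<close> and \<open>E\<^sub>k\<close> for the conditional expectation onto \<open>r\<^sup>-\<^sup>k(B)\<close>. Harmonicity of \<open>h\<close>
  gives \<open>\<integral> \<bar>m\<^sub>0\<bar>\<^sup>2 h \<cdot> (\<phi> \<circ> r) d\<rho> = \<integral> h \<phi> d\<rho>\<close>, which is the isometry property, and for \<open>f = S\<^sub>0\<^sup>k g\<^sub>k\<close>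
  it gives \<open>E\<^sub>k u = (\<bar>g\<^sub>k\<bar>\<^sup>2 h) \<circ> r\<^sup>k\<close>. Since \<open>r\<close> is averaging, the reverse martingale \<open>E\<^sub>k u\<close> converges in
  \<open>L\<^sup>1\<close> to \<open>c = \<integral> u d\<rho>\<close>, so \<open>u \<cdot> (h \<circ> r\<^sup>k)\<close> is \<open>L\<^sup>1\<close>-asymptotic to \<open>c \<bar>S\<^sub>0\<^sup>k 1\<bar>\<^sup>2 h\<close>, which depends on \<open>f\<close>
  only through \<open>c\<close>. As \<open>\<integral> D \<cdot> (h \<circ> r\<^sup>k) d\<rho> \<rightarrow> \<integral> D d\<rho> \<integral> h d\<rho>\<close>, two elements of the intersection with the same
  norm have the same \<open>u\<close>. This applies to \<open>f\<close> and its preimage \<open>g\<^sub>1\<close>, so \<open>E\<^sub>k u = u \<circ> r\<^sup>k\<close> for all \<open>k\<close>,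
  whence \<open>u = c\<close>. If \<open>c > 0\<close>, then \<open>h > 0\<close> and \<open>h \<circ> r = \<bar>m\<^sub>0\<bar>\<^sup>2 h\<close>, and a strict concavity argument with
  the normalization of \<open>m\<^sub>0\<close> forces \<open>\<bar>m\<^sub>0\<bar> = 1\<close>.
\<close>

section \<open>Reverse martingales with trivial tail\<close>

text \<open>The variance of |g| is nonnegative. This turns \<open>L^2\<close> bounds on martingale
  increments into \<open>L^1\<close> bounds.\<close>

lemma (in prob_space) expectation_abs_square_le:
  fixes g :: "'a \<Rightarrow> real"
  assumes "integrable M g" "integrable M (\<lambda>x. (g x)\<^sup>2)"
  shows "(expectation (\<lambda>x. \<bar>g x\<bar>))\<^sup>2 \<le> expectation (\<lambda>x. (g x)\<^sup>2)"
  using variance_positive[of "\<lambda>x. \<bar>g x\<bar>"] variance_eq[of "\<lambda>x. \<bar>g x\<bar>"] assms by simp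

text \<open>The sign of the conditional expectation is F-measurable, so testing against it replaces
  the conditional expectation by f itself.\<close>

lemma (in sigma_finite_subalgebra) real_cond_exp_contraction:
  assumes f: "integrable M f"
  shows "(\<integral>x. \<bar>real_cond_exp M F f x\<bar> \<partial>M) \<le> (\<integral>x. \<bar>f x\<bar> \<partial>M)"
proof -
  let ?s = "\<lambda>x. sgn (real_cond_exp M F f x)"
  have m[measurable]: "f \<in> borel_measurable M" "?s \<in> borel_measurable F" "?s \<in> borel_measurable M"
    using f by (auto intro: measurable_from_subalg[OF subalg])
  have i: "integrable M (\<lambda>x. ?s x * f x)"
    by (rule Bochner_Integration.integrable_bound[OF f]) (auto simp: abs_mult sgn_if)
  have "(\<integral>x. \<bar>real_cond_exp M F f x\<bar> \<partial>M) = (\<integral>x. ?s x * real_cond_exp M F f x \<partial>M)"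
    by (simp add: linordered_idom_class.abs_sgn mult.commute)
  also have "\<dots> = (\<integral>x. ?s x * f x \<partial>M)"
    by (rule real_cond_exp_intg(2)[OF i m(2,1)])
  also have "\<dots> \<le> (\<integral>x. \<bar>f x\<bar> \<partial>M)"
    using i f by (intro integral_mono) (auto simp: sgn_if)
  finally show ?thesis .
qed

lemma (in prob_space) sigma_finite_subalgebra_prob:
  "subalgebra M F \<Longrightarrow> sigma_finite_subalgebra M F"
  using finite_measure_axioms finite_measure_subalgebra.intro finite_measure_subalgebra_axioms.intro
    finite_measure_subalgebra_is_sigma_finite by blast

text \<open>By the tower property the coarser expectation minus c is the conditional expectation of
  the finer one minus c, and the contraction applies. It lets convergence along a subsequence
  control the full sequence.\<close>

lemma (in prob_space) expectation_abs_cond_exp_minus_antimono: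
  assumes F: "subalgebra M F" and G: "subalgebra F G" and u: "integrable M u"
  shows "expectation (\<lambda>x. \<bar>real_cond_exp M G u x - c\<bar>)
    \<le> expectation (\<lambda>x. \<bar>real_cond_exp M F u x - c\<bar>)"
proof -
  have MG: "subalgebra M G" using F G by (auto simp: subalgebra_def)
  interpret F: sigma_finite_subalgebra M F by (rule sigma_finite_subalgebra_prob[OF F])
  interpret G: sigma_finite_subalgebra M G by (rule sigma_finite_subalgebra_prob[OF MG])
  have i: "integrable M (real_cond_exp M F u)" using u by (rule F.real_cond_exp_int)
  have "AE x in M. real_cond_exp M G (\<lambda>x. real_cond_exp M F u x - c) x = real_cond_exp M G u x - c"
    using G.real_cond_exp_diff[OF i integrable_const[of c]] G.real_cond_exp_nested_subalg[OF F G u]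
      G.real_cond_exp_F_meas[OF integrable_const[of c] borel_measurable_const]
    by eventually_elim simp
  then have "expectation (\<lambda>x. \<bar>real_cond_exp M G u x - c\<bar>)
      = expectation (\<lambda>x. \<bar>real_cond_exp M G (\<lambda>x. real_cond_exp M F u x - c) x\<bar>)"
    by (intro integral_cong_AE) auto
  also have "\<dots> \<le> expectation (\<lambda>x. \<bar>real_cond_exp M F u x - c\<bar>)"
    using i by (intro G.real_cond_exp_contraction) auto
  finally show ?thesis .
qed

text \<open>The squared \<open>L\<^sup>2\<close> norms of the conditional expectations decrease, so these form an \<open>L\<^sup>2\<close> Cauchy
  sequence; a fast subsequence converges almost everywhere, to a function measurable for every
  \<open>F n\<close>.\<close>

lemma (in prob_space) cond_exp_tendsto_trivial_tail_bounded:
  fixes F :: "nat \<Rightarrow> 'a measure" and u :: "'a \<Rightarrow> real"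
  assumes sub: "\<And>n. subalgebra M (F n)"
    and dec: "\<And>n m. n \<le> m \<Longrightarrow> subalgebra (F n) (F m)"
    and trivial: "\<And>v::'a \<Rightarrow> real. (\<And>n. v \<in> borel_measurable (F n)) \<Longrightarrow> integrable M v
      \<Longrightarrow> \<exists>c. AE x in M. v x = c"
    and u[measurable]: "u \<in> borel_measurable M" and B: "\<And>x. \<bar>u x\<bar> \<le> B"
  shows "(\<lambda>n. expectation (\<lambda>x. \<bar>real_cond_exp M (F n) u x - expectation u\<bar>)) \<longlonglongrightarrow> 0"
proof -
  define E where "E n = real_cond_exp M (F n) u" for n
  have ui: "integrable M u" by (rule integrable_const_bound[of _ B]) (use B in auto)
  have Em[measurable]: "E n \<in> borel_measurable M" "E n \<in> borel_measurable (F n)" for n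
    unfolding E_def by auto
  have Em': "E m \<in> borel_measurable (F n)" if "n \<le> m" for n m
    using measurable_from_subalg[OF dec[OF that]] Em(2) by blast
  have EB: "AE x in M. \<bar>E n x\<bar> \<le> B" for n
  proof -
    interpret sigma_finite_subalgebra M "F n" by (rule sigma_finite_subalgebra_prob[OF sub])
    have "u x \<le> B" "- B \<le> u x" for x using B[of x] by auto
    then have "AE x in M. E n x \<le> B" "AE x in M. - B \<le> E n x"
      unfolding E_def using ui by (auto intro!: real_cond_exp_ge_c real_cond_exp_le_c)
    then show ?thesis by eventually_elim auto
  qed
  have Ei[simp]: "integrable M (E n)" for n
    by (rule integrable_const_bound[OF _ Em(1), of _ B]) (use EB in auto)
  have EEi[simp]: "integrable M (\<lambda>x. E n x * E m x)" for n m
  proof (rule integrable_const_bound[of _ "B * B"])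
    show "AE x in M. norm (E n x * E m x) \<le> B * B"
      using EB[of n] EB[of m] by eventually_elim (auto simp: abs_mult intro!: mult_mono)
  qed auto
  have Eint: "expectation (E n) = expectation u" for n
  proof -
    interpret sigma_finite_subalgebra M "F n" by (rule sigma_finite_subalgebra_prob[OF sub])
    show ?thesis unfolding E_def by (rule real_cond_exp_int(2)[OF ui])
  qed
  define a where "a n = expectation (\<lambda>x. E n x * E n x)" for n
  \<comment> \<open>Orthogonality of increments: \<open>E m\<close> is measurable for the coarser
    algebra \<open>F m\<close>, onto which \<open>E n\<close> projects as
    \<open>E m\<close>.\<close>
  have cross: "expectation (\<lambda>x. E m x * E n x) = a m" if "n \<le> m" for n m
  proof -
    interpret sigma_finite_subalgebra M "F m" by (rule sigma_finite_subalgebra_prob[OF sub])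
    have "expectation (\<lambda>x. E m x * E n x) = expectation (\<lambda>x. E m x * real_cond_exp M (F m) (E n) x)"
      by (rule real_cond_exp_intg(2)[symmetric]) auto
    also have "\<dots> = a m"
      unfolding a_def using real_cond_exp_nested_subalg[OF sub dec[OF that] ui]
      by (intro integral_cong_AE) (auto simp: E_def)
    finally show ?thesis .
  qed
  have sq: "expectation (\<lambda>x. (E n x - E m x)\<^sup>2) = a n - a m" if "n \<le> m" for n m
  proof -
    have "expectation (\<lambda>x. (E n x - E m x)\<^sup>2)
        = expectation (\<lambda>x. E n x * E n x + E m x * E m x - 2 * (E m x * E n x))"
      by (intro Bochner_Integration.integral_cong) (auto simp: power2_eq_square algebra_simps)
    also have "\<dots> = a n - a m"
      using cross[OF that] by (simp add: a_def)
    finally show ?thesis .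
  qed
  have sqi: "integrable M (\<lambda>x. (E n x - E m x)\<^sup>2)" for n m
  proof -
    have "integrable M (\<lambda>x. E n x * E n x + E m x * E m x - 2 * (E m x * E n x))" by simp
    then show ?thesis by (simp add: power2_eq_square algebra_simps)
  qed
  have "decseq a"
  proof (unfold decseq_def, intro allI impI)
    fix n m :: nat assume nm: "n \<le> m"
    have "0 \<le> expectation (\<lambda>x. (E n x - E m x)\<^sup>2)" by simp
    then show "a m \<le> a n" using sq[OF nm] by simp
  qed
  moreover have a0: "0 \<le> a n" for n unfolding a_def by simp
  ultimately obtain L where "a \<longlonglongrightarrow> L"
    using decseq_convergent[of a 0] by blast
  then have Ca: "Cauchy a" by (rule LIMSEQ_imp_Cauchy)
  have "\<exists>K. \<forall>m\<ge>K. \<forall>n\<ge>K. \<bar>a m - a n\<bar> < (1/4) ^ j" for j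
    using Ca[unfolded Cauchy_def, rule_format, of "(1/4)^j"] by (auto simp: dist_real_def)
  then obtain K where K: "\<And>j m n. m \<ge> K j \<Longrightarrow> n \<ge> K j \<Longrightarrow> \<bar>a m - a n\<bar> < (1/4) ^ j"
    by metis
  \<comment> \<open>A monotone choice dominating both \<open>K j\<close>, which makes the increments
    small, and j, which sends the indices to infinity.\<close>
  define k where "k j = j + (\<Sum>i\<le>j. K i)" for j
  have k_ge: "K j \<le> k j" "j \<le> k j" for j
    using member_le_sum[of j "{..j}" K] unfolding k_def by auto
  have k_mono: "k j \<le> k (Suc j)" for j unfolding k_def by simp
  have step: "expectation (\<lambda>x. \<bar>E (k (Suc j)) x - E (k j) x\<bar>) \<le> (1/2) ^ j" for j
  proof -
    have "(expectation (\<lambda>x. \<bar>E (k j) x - E (k (Suc j)) x\<bar>))\<^sup>2 \<le> a (k j) - a (k (Suc j))"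
      using expectation_abs_square_le[OF _ sqi[of "k j" "k (Suc j)"]] sq[OF k_mono[of j]] by simp
    also have "\<dots> \<le> (1/4) ^ j"
      using K[of j "k j" "k (Suc j)"] k_ge[of j] k_mono[of j] by linarith
    also have "\<dots> = ((1/2) ^ j)\<^sup>2"
      by (simp add: power_mult[symmetric] power2_eq_square power_mult_distrib[symmetric])
    finally have "expectation (\<lambda>x. \<bar>E (k j) x - E (k (Suc j)) x\<bar>) \<le> (1/2) ^ j"
      by (rule power2_le_imp_le) simp
    then show ?thesis by (simp only: abs_minus_commute)
  qed
  \<comment> \<open>The increments have summable \<open>L^1\<close> norms, so almost everywhere they
    form an absolutely convergent series.\<close>
  have "(\<integral>\<^sup>+x. (\<Sum>j. ennreal \<bar>E (k (Suc j)) x - E (k j) x\<bar>) \<partial>M)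
      = (\<Sum>j. \<integral>\<^sup>+x. ennreal \<bar>E (k (Suc j)) x - E (k j) x\<bar> \<partial>M)"
    by (rule nn_integral_suminf) auto
  also have "\<dots> = (\<Sum>j. ennreal (expectation (\<lambda>x. \<bar>E (k (Suc j)) x - E (k j) x\<bar>)))"
    by (simp add: nn_integral_eq_integral)
  also have "\<dots> \<le> (\<Sum>j. ennreal ((1/2) ^ j))"
    by (intro suminf_le) (auto intro!: ennreal_leI step)
  also have "\<dots> < \<infinity>"
    by (subst suminf_ennreal_eq[OF _ geometric_sums[of "1/2::real"]]) auto
  finally have "AE x in M. (\<Sum>j. ennreal \<bar>E (k (Suc j)) x - E (k j) x\<bar>) \<noteq> \<infinity>"
    by (intro nn_integral_noteq_infinite) auto
  then have conv: "AE x in M. convergent (\<lambda>j. E (k j) x)"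
  proof eventually_elim
    case (elim x)
    then have "summable (\<lambda>j. \<bar>E (k (Suc j)) x - E (k j) x\<bar>)"
      by (intro summable_suminf_not_top) auto
    then have "summable (\<lambda>j. E (k (Suc j)) x - E (k j) x)"
      by (rule summable_rabs_cancel)
    then show ?case
      using sum_lessThan_telescope[of "\<lambda>j. E (k j) x"]
      by (simp add: summable_iff_convergent convergent_diff_const_right_iff)
  qed
  define v where "v x = lim (\<lambda>j. E (k j) x)" for x
  have v_lim: "AE x in M. (\<lambda>j. E (k j) x) \<longlonglongrightarrow> v x"
    using conv by eventually_elim (auto simp: v_def convergent_LIMSEQ_iff)
  \<comment> \<open>Dropping the first n terms leaves the value of \<open>lim\<close> unchanged at
    every point, even where the sequence diverges, because the defining predicate of
    \<open>lim\<close> is the same. The remaining terms are all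
    \<open>F n\<close>-measurable.\<close>
  have v_F: "v \<in> borel_measurable (F n)" for n
  proof -
    have "v = (\<lambda>x. lim (\<lambda>j. E (k (j + n)) x))"
      unfolding v_def lim_def
      by (intro ext arg_cong[where f = The]) (auto intro!: LIMSEQ_ignore_initial_segment dest: LIMSEQ_offset)
    also have "\<dots> \<in> borel_measurable (F n)"
    proof (rule borel_measurable_lim_metric)
      fix j show "E (k (j + n)) \<in> borel_measurable (F n)"
        using k_ge(2)[of "j + n"] by (intro Em') auto
    qed
    finally show ?thesis .
  qed
  have [measurable]: "v \<in> borel_measurable M" by (rule measurable_from_subalg[OF sub v_F])
  have dom: "AE x in M. norm (E (k j) x) \<le> B" for j using EB by simp
  have "integrable M v"
    by (rule integrable_dominated_convergence[OF _ _ _ v_lim dom]) auto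
  with trivial v_F obtain c where c: "AE x in M. v x = c" by blast
  \<comment> \<open>Every \<open>E n\<close> has the mean of u, which identifies the constant
    limit.\<close>
  have "(\<lambda>j. expectation (E (k j))) \<longlonglongrightarrow> expectation v"
    by (rule integral_dominated_convergence[OF _ _ _ v_lim dom]) auto
  then have "expectation v = expectation u"
    by (simp add: Eint LIMSEQ_const_iff)
  moreover have "expectation v = expectation (\<lambda>x. c)"
    using c by (intro integral_cong_AE) auto
  ultimately have c_eq: "c = expectation u" by (simp add: prob_space)
  have sublim: "(\<lambda>j. expectation (\<lambda>x. \<bar>E (k j) x - expectation u\<bar>)) \<longlonglongrightarrow> expectation (\<lambda>x. 0)"
  proof (rule integral_dominated_convergence[where w = "\<lambda>x. B + \<bar>expectation u\<bar>"])
    show "AE x in M. (\<lambda>j. \<bar>E (k j) x - expectation u\<bar>) \<longlonglongrightarrow> 0"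
      using v_lim c
    proof eventually_elim
      case (elim x)
      then have "(\<lambda>j. E (k j) x - expectation u) \<longlonglongrightarrow> v x - c"
        unfolding c_eq by (intro tendsto_intros)
      then show ?case using elim(2) by (simp add: tendsto_rabs_zero)
    qed
    show "AE x in M. norm \<bar>E (k j) x - expectation u\<bar> \<le> B + \<bar>expectation u\<bar>" for j
      using EB[of "k j"] by eventually_elim auto
  qed auto
  have anti: "expectation (\<lambda>x. \<bar>E m x - expectation u\<bar>) \<le> expectation (\<lambda>x. \<bar>E n x - expectation u\<bar>)"
    if "n \<le> m" for n m
    unfolding E_def by (rule expectation_abs_cond_exp_minus_antimono[OF sub dec[OF that] ui])
  show ?thesis
  proof (rule LIMSEQ_I)
    fix e :: real assume "0 < e"
    then obtain j where j: "expectation (\<lambda>x. \<bar>E (k j) x - expectation u\<bar>) < e"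
      using LIMSEQ_D[OF sublim, of e] by auto
    show "\<exists>n0. \<forall>n\<ge>n0. norm (expectation (\<lambda>x. \<bar>real_cond_exp M (F n) u x - expectation u\<bar>) - 0) < e"
      using anti[of "k j"] j by (intro exI[of _ "k j"]) (auto simp: E_def[symmetric] intro: le_less_trans)
  qed
qed

text \<open>Truncation at height N reduces to the bounded case: conditional expectation contracts
  \<open>L^1\<close>, so the truncation error is small uniformly in n.\<close>

lemma (in prob_space) cond_exp_tendsto_trivial_tail:
  fixes F :: "nat \<Rightarrow> 'a measure" and u :: "'a \<Rightarrow> real"
  assumes sub: "\<And>n. subalgebra M (F n)"
    and dec: "\<And>n m. n \<le> m \<Longrightarrow> subalgebra (F n) (F m)"
    and trivial: "\<And>v::'a \<Rightarrow> real. (\<And>n. v \<in> borel_measurable (F n)) \<Longrightarrow> integrable M v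
      \<Longrightarrow> \<exists>c. AE x in M. v x = c"
    and u: "integrable M u"
  shows "(\<lambda>n. expectation (\<lambda>x. \<bar>real_cond_exp M (F n) u x - expectation u\<bar>)) \<longlonglongrightarrow> 0"
proof (rule LIMSEQ_I)
  fix e :: real assume e: "0 < e"
  have um[measurable]: "u \<in> borel_measurable M" using u by auto
  define w where "w N x = max (- real N) (min (u x) (real N))" for N x
  have wm[measurable]: "w N \<in> borel_measurable M" for N unfolding w_def by auto
  have wi: "integrable M (w N)" for N
    by (rule integrable_const_bound[of _ "real N"]) (auto simp: w_def)
  have "(\<lambda>N. expectation (\<lambda>x. \<bar>u x - w N x\<bar>)) \<longlonglongrightarrow> expectation (\<lambda>x. 0)"
  proof (rule integral_dominated_convergence[where w = "\<lambda>x. \<bar>u x\<bar>"])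
    show "AE x in M. (\<lambda>N. \<bar>u x - w N x\<bar>) \<longlonglongrightarrow> 0"
    proof (intro AE_I2 tendsto_eventually)
      fix x
      obtain N0 where "\<bar>u x\<bar> \<le> real N0" using real_arch_simple by blast
      then show "\<forall>\<^sub>F N in sequentially. \<bar>u x - w N x\<bar> = 0"
        by (intro eventually_sequentiallyI[of N0]) (auto simp: w_def)
    qed
  qed (use u in \<open>auto simp: w_def\<close>)
  then obtain N where N: "expectation (\<lambda>x. \<bar>u x - w N x\<bar>) < e / 4"
    using LIMSEQ_D[of _ _ "e / 4"] e by fastforce
  have "(\<lambda>n. expectation (\<lambda>x. \<bar>real_cond_exp M (F n) (w N) x - expectation (w N)\<bar>)) \<longlonglongrightarrow> 0"
    by (rule cond_exp_tendsto_trivial_tail_bounded[OF sub dec trivial wm, where B = "real N"])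
       (auto simp: w_def)
  then obtain n0 where n0: "\<And>n. n \<ge> n0 \<Longrightarrow>
      expectation (\<lambda>x. \<bar>real_cond_exp M (F n) (w N) x - expectation (w N)\<bar>) < e / 4"
    using LIMSEQ_D[of _ _ "e / 4"] e by fastforce
  have "expectation (\<lambda>x. \<bar>real_cond_exp M (F n) u x - expectation u\<bar>) < e" if "n \<ge> n0" for n
  proof -
    interpret sigma_finite_subalgebra M "F n" by (rule sigma_finite_subalgebra_prob[OF sub])
    let ?E = "real_cond_exp M (F n)"
    have i: "integrable M (?E u)" "integrable M (?E (w N))" "integrable M (?E (\<lambda>x. u x - w N x))"
      using u wi by (auto intro: real_cond_exp_int)
    have "\<bar>expectation (w N) - expectation u\<bar> \<le> expectation (\<lambda>x. \<bar>u x - w N x\<bar>)"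
      using u wi integral_abs_bound[of M "\<lambda>x. u x - w N x"] by (simp add: abs_minus_commute)
    then have d: "\<bar>expectation (w N) - expectation u\<bar> < e / 4" using N by simp
    \<comment> \<open>Three errors below e/4 each: conditioning the truncation error, the bounded
      case, and the change of the mean.\<close>
    have "expectation (\<lambda>x. \<bar>?E u x - expectation u\<bar>)
        \<le> expectation (\<lambda>x. \<bar>?E (\<lambda>x. u x - w N x) x\<bar> + \<bar>?E (w N) x - expectation (w N)\<bar>
            + \<bar>expectation (w N) - expectation u\<bar>)"
    proof (rule integral_mono_AE)
      show "AE x in M. \<bar>?E u x - expectation u\<bar> \<le> \<bar>?E (\<lambda>x. u x - w N x) x\<bar>
          + \<bar>?E (w N) x - expectation (w N)\<bar> + \<bar>expectation (w N) - expectation u\<bar>"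
        using real_cond_exp_diff[OF u wi[of N]] by eventually_elim linarith
    qed (use i in auto)
    also have "\<dots> = expectation (\<lambda>x. \<bar>?E (\<lambda>x. u x - w N x) x\<bar>)
        + expectation (\<lambda>x. \<bar>?E (w N) x - expectation (w N)\<bar>) + \<bar>expectation (w N) - expectation u\<bar>"
      using i by (simp add: prob_space)
    also have "\<dots> < e / 4 + e / 4 + e / 4"
      using real_cond_exp_contraction[of "\<lambda>x. u x - w N x"] u wi N n0[OF that] d by simp
    finally show ?thesis using e by simp
  qed
  then show "\<exists>n0. \<forall>n\<ge>n0. norm (expectation (\<lambda>x. \<bar>real_cond_exp M (F n) u x - expectation u\<bar>) - 0) < e"
    by auto
qed

section \<open>Weights harmonic under an endomorphism\<close>

text \<open>Fibres are eliminated here: \<open>harmonic\<close> is the fibre equation for h tested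
  against functions of \<open>r x\<close>. Nonnegative integrals keep the identities free of
  integrability conditions on \<phi>.\<close>

locale harmonic_weight = prob_space \<rho> for \<rho> :: "'a measure" +
  fixes r :: "'a \<Rightarrow> 'a" and m :: "'a \<Rightarrow> complex" and h :: "'a \<Rightarrow> real"
  assumes r[measurable]: "r \<in> \<rho> \<rightarrow>\<^sub>M \<rho>"
    and m[measurable]: "m \<in> borel_measurable \<rho>"
    and h[measurable]: "h \<in> borel_measurable \<rho>"
    and h_nonneg[simp]: "\<And>x. 0 \<le> h x"
    and h_bounded: "\<exists>B. AE x in \<rho>. h x \<le> B"
    and invariant: "\<And>\<phi>::'a \<Rightarrow> ennreal. \<phi> \<in> borel_measurable \<rho> \<Longrightarrow> (\<integral>\<^sup>+x. \<phi> (r x) \<partial>\<rho>) = (\<integral>\<^sup>+x. \<phi> x \<partial>\<rho>)"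
    and harmonic: "\<And>\<phi>::'a \<Rightarrow> ennreal. \<phi> \<in> borel_measurable \<rho> \<Longrightarrow>
      (\<integral>\<^sup>+x. ennreal ((norm (m x))\<^sup>2 * h x) * \<phi> (r x) \<partial>\<rho>) = (\<integral>\<^sup>+x. ennreal (h x) * \<phi> x \<partial>\<rho>)"
begin

section \<open>The weighted composition operator on functions\<close>

abbreviation "M \<equiv> weighted_measure \<rho> h"

text \<open>The operator \<open>S0 M m r\<close> on the level of representatives.\<close>

definition T :: "('a \<Rightarrow> complex) \<Rightarrow> 'a \<Rightarrow> complex" where "T g x = m x * g (r x)"

lemma T_measurable[measurable]: "g \<in> borel_measurable \<rho> \<Longrightarrow> T g \<in> borel_measurable \<rho>"
proof -
  assume [measurable]: "g \<in> borel_measurable \<rho>"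
  have "(\<lambda>x. m x * g (r x)) \<in> borel_measurable \<rho>" by measurable
  then show ?thesis by (simp add: T_def[abs_def])
qed

lemma T_funpow_measurable[measurable]: "g \<in> borel_measurable \<rho> \<Longrightarrow> (T ^^ k) g \<in> borel_measurable \<rho>"
  by (induction k) auto

lemma r_funpow[measurable]: "(r ^^ k) \<in> \<rho> \<rightarrow>\<^sub>M \<rho>"
  by (rule measurable_compose_n) (rule r)

lemma AE_M: "(AE x in M. P x) \<longleftrightarrow> (AE x in \<rho>. 0 < h x \<longrightarrow> P x)"
  by (subst AE_density) auto

lemma L2_fun_M: "f \<in> L2_fun M \<longleftrightarrow> f \<in> borel_measurable \<rho> \<and> integrable \<rho> (\<lambda>x. (norm (f x))\<^sup>2 * h x)"
proof -
  have "integrable M (\<lambda>x. (norm (f x))\<^sup>2) \<longleftrightarrow> integrable \<rho> (\<lambda>x. (norm (f x))\<^sup>2 * h x)"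
    if "f \<in> borel_measurable \<rho>"
    using that by (subst integrable_density) (auto simp: mult.commute)
  then show ?thesis by (auto simp: L2_fun_def)
qed

lemma invariant_funpow:
  fixes \<phi> :: "'a \<Rightarrow> ennreal"
  assumes \<phi>: "\<phi> \<in> borel_measurable \<rho>"
  shows "(\<integral>\<^sup>+x. \<phi> ((r ^^ k) x) \<partial>\<rho>) = (\<integral>\<^sup>+x. \<phi> x \<partial>\<rho>)"
  using \<phi>
proof (induction k arbitrary: \<phi>)
  case (Suc k)
  note [measurable] = Suc.prems
  show ?case using Suc.IH[of "\<lambda>x. \<phi> (r x)"] invariant[OF Suc.prems] by simp
qed simp

lemma expectation_funpow:
  fixes \<phi> :: "'a \<Rightarrow> real"
  assumes [measurable]: "\<phi> \<in> borel_measurable \<rho>" and nn: "\<And>x. 0 \<le> \<phi> x"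
  shows "expectation (\<lambda>x. \<phi> ((r ^^ k) x)) = expectation \<phi>"
  using invariant_funpow[of "\<lambda>x. ennreal (\<phi> x)" k] nn by (simp add: integral_eq_nn_integral)

lemma integrable_funpow:
  fixes \<phi> :: "'a \<Rightarrow> real"
  assumes i: "integrable \<rho> \<phi>"
  shows "integrable \<rho> (\<lambda>x. \<phi> ((r ^^ k) x))"
proof -
  have [measurable]: "\<phi> \<in> borel_measurable \<rho>" using i by auto
  show ?thesis
    using i invariant_funpow[of "\<lambda>x. ennreal (norm (\<phi> x))" k] by (simp add: integrable_iff_bounded)
qed

text \<open>Invariance is applied to the indicator of the exceptional set.\<close>

lemma AE_funpow:
  assumes P: "AE x in \<rho>. P x" and [measurable]: "Measurable.pred \<rho> P"
  shows "AE x in \<rho>. P ((r ^^ k) x)"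
proof -
  let ?\<phi> = "\<lambda>x. if P x then 0 else 1 :: ennreal"
  have "(\<integral>\<^sup>+x. ?\<phi> ((r ^^ k) x) \<partial>\<rho>) = (\<integral>\<^sup>+x. ?\<phi> x \<partial>\<rho>)"
    by (rule invariant_funpow) measurable
  also have "\<dots> = 0" using P by (subst nn_integral_0_iff_AE) auto
  finally have "AE x in \<rho>. ?\<phi> ((r ^^ k) x) = 0" by (subst (asm) nn_integral_0_iff_AE) auto
  then show ?thesis by eventually_elim (auto split: if_splits)
qed

text \<open>Each step spends one factor \<open>|m|^2 h\<close> on \<open>harmonic\<close>, the rest
  of the integrand being absorbed into the test function. Thus \<open>r ^^ k\<close> pushes the
  measure with density \<open>|T^k g|^2 h\<close> to the one with density
  \<open>|g|^2 h\<close>.\<close>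

lemma harmonic_T_funpow:
  fixes \<phi> :: "'a \<Rightarrow> ennreal"
  assumes [measurable]: "g \<in> borel_measurable \<rho>" and "\<phi> \<in> borel_measurable \<rho>"
  shows "(\<integral>\<^sup>+x. ennreal ((norm ((T ^^ k) g x))\<^sup>2 * h x) * \<phi> ((r ^^ k) x) \<partial>\<rho>)
    = (\<integral>\<^sup>+x. ennreal ((norm (g x))\<^sup>2 * h x) * \<phi> x \<partial>\<rho>)"
  using assms(2)
proof (induction k)
  case (Suc k)
  note [measurable] = Suc.prems
  let ?\<psi> = "\<lambda>x. ennreal ((norm ((T ^^ k) g x))\<^sup>2) * \<phi> ((r ^^ k) x)"
  have "(\<integral>\<^sup>+x. ennreal ((norm ((T ^^ Suc k) g x))\<^sup>2 * h x) * \<phi> ((r ^^ Suc k) x) \<partial>\<rho>)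
      = (\<integral>\<^sup>+x. ennreal ((norm (m x))\<^sup>2 * h x) * ?\<psi> (r x) \<partial>\<rho>)"
    by (intro nn_integral_cong)
       (simp add: T_def norm_mult power_mult_distrib funpow_swap1[of r] ennreal_mult' mult_ac)
  also have "\<dots> = (\<integral>\<^sup>+x. ennreal (h x) * ?\<psi> x \<partial>\<rho>)" by (rule harmonic) measurable
  also have "\<dots> = (\<integral>\<^sup>+x. ennreal ((norm ((T ^^ k) g x))\<^sup>2 * h x) * \<phi> ((r ^^ k) x) \<partial>\<rho>)"
    by (intro nn_integral_cong) (simp add: ennreal_mult' mult_ac)
  finally show ?case using Suc by simp
qed simp

lemma T_norm:
  assumes "g \<in> borel_measurable \<rho>"
  shows "(\<integral>\<^sup>+x. ennreal ((norm (T g x))\<^sup>2 * h x) \<partial>\<rho>) = (\<integral>\<^sup>+x. ennreal ((norm (g x))\<^sup>2 * h x) \<partial>\<rho>)"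
  using harmonic_T_funpow[OF assms, of "\<lambda>_. 1" 1] by simp

lemma T_L2: "f \<in> L2_fun M \<Longrightarrow> T f \<in> L2_fun M"
  using T_norm[of f] by (auto simp: L2_fun_M integrable_iff_bounded)

lemma T_funpow_L2: "f \<in> L2_fun M \<Longrightarrow> (T ^^ k) f \<in> L2_fun M"
  by (induction k) (auto intro: T_L2)

text \<open>The norm identity for T is applied to f - g. One direction makes T well defined on
  classes, the other makes it injective.\<close>

lemma T_AE_eq_iff:
  assumes [measurable]: "f \<in> borel_measurable \<rho>" "g \<in> borel_measurable \<rho>"
  shows "(AE x in M. T f x = T g x) \<longleftrightarrow> (AE x in M. f x = g x)"
proof -
  have eq: "(AE x in M. f x = g x) \<longleftrightarrow> (\<integral>\<^sup>+x. ennreal ((norm (f x - g x))\<^sup>2 * h x) \<partial>\<rho>) = 0"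
    if [measurable]: "f \<in> borel_measurable \<rho>" "g \<in> borel_measurable \<rho>" for f g :: "'a \<Rightarrow> complex"
  proof -
    have "(AE x in M. f x = g x) \<longleftrightarrow> (AE x in \<rho>. ennreal ((norm (f x - g x))\<^sup>2 * h x) = 0)"
      unfolding AE_M by (intro AE_cong) (auto simp: ennreal_eq_0_iff less_le mult_le_0_iff dest: antisym[OF _ h_nonneg])
    then show ?thesis by (subst nn_integral_0_iff_AE) auto
  qed
  have "T f x - T g x = T (\<lambda>x. f x - g x) x" for x by (simp add: T_def right_diff_distrib)
  then show ?thesis using T_norm[of "\<lambda>x. f x - g x"] by (simp add: eq)
qed

text \<open>Splits off the cocycle \<open>m(x) m(r x) ... m(r^(k-1) x)\<close>, which does not
  depend on g.\<close>

lemma T_funpow_eq: "(T ^^ k) g x = (T ^^ k) (\<lambda>_. 1) x * g ((r ^^ k) x)"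
  by (induction k arbitrary: x) (simp_all add: T_def funpow_swap1[of r])

section \<open>Conditional expectations onto preimage algebras of iterates\<close>

definition F :: "nat \<Rightarrow> 'a measure" where "F k = vimage_algebra (space \<rho>) (r ^^ k) \<rho>"

lemma sets_F: "sets (F k) = {(r ^^ k) -` A \<inter> space \<rho> | A. A \<in> sets \<rho>}"
  unfolding F_def by (rule sets_vimage_algebra2) (use r_funpow[of k] in \<open>auto simp: measurable_def\<close>)

lemma subalgebra_F: "subalgebra \<rho> (F k)"
  unfolding subalgebra_def sets_F by (auto simp: F_def)

lemma subalgebra_F_mono:
  assumes "n \<le> k" shows "subalgebra (F n) (F k)"
proof -
  have *: "(r ^^ k) -` A \<inter> space \<rho> = (r ^^ n) -` ((r ^^ (k - n)) -` A \<inter> space \<rho>) \<inter> space \<rho>" for A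
  proof -
    have "(r ^^ k) x = (r ^^ (k - n)) ((r ^^ n) x)" for x
      using assms by (metis comp_apply funpow_add le_add_diff_inverse2)
    moreover have "(r ^^ n) x \<in> space \<rho>" if "x \<in> space \<rho>" for x
      using that by (rule measurable_space[OF r_funpow])
    ultimately show ?thesis by auto
  qed
  have "sets (F k) \<subseteq> sets (F n)"
  proof
    fix B assume "B \<in> sets (F k)"
    then obtain A where "A \<in> sets \<rho>" "B = (r ^^ k) -` A \<inter> space \<rho>" by (auto simp: sets_F)
    then show "B \<in> sets (F n)"
      using *[of A] measurable_sets[OF r_funpow[of "k - n"]] unfolding sets_F by blast
  qed
  then show ?thesis by (simp add: subalgebra_def F_def)
qed

lemma funpow_measurable_F: "g \<in> \<rho> \<rightarrow>\<^sub>M N \<Longrightarrow> (\<lambda>x. g ((r ^^ k) x)) \<in> F k \<rightarrow>\<^sub>M N"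
  unfolding F_def
  by (rule measurable_compose[OF measurable_vimage_algebra1]) (use measurable_space[OF r_funpow] in auto)

text \<open>The hypothesis \<open>transfer\<close> says that \<open>r ^^ k\<close> pushes u d\<rho>
  to v d\<rho>. Tested on an indicator of C, and combined with invariance, it equates the integrals
  of u and of v composed with \<open>r ^^ k\<close> over the preimage of C; these preimages make up
  \<open>F k\<close>.\<close>

lemma cond_exp_F_eq:
  assumes u: "integrable \<rho> u" "\<And>x. 0 \<le> u x" and v: "integrable \<rho> v" "\<And>x. 0 \<le> v x"
    and transfer: "\<And>\<phi>::'a \<Rightarrow> ennreal. \<phi> \<in> borel_measurable \<rho> \<Longrightarrow>
      (\<integral>\<^sup>+x. ennreal (u x) * \<phi> ((r ^^ k) x) \<partial>\<rho>) = (\<integral>\<^sup>+x. ennreal (v x) * \<phi> x \<partial>\<rho>)"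
  shows "AE x in \<rho>. real_cond_exp \<rho> (F k) u x = v ((r ^^ k) x)"
proof -
  interpret sigma_finite_subalgebra \<rho> "F k" by (rule sigma_finite_subalgebra_prob[OF subalgebra_F])
  have [measurable]: "u \<in> borel_measurable \<rho>" "v \<in> borel_measurable \<rho>" using u v by auto
  show ?thesis
  proof (rule real_cond_exp_charact)
    show "integrable \<rho> (\<lambda>x. v ((r ^^ k) x))" using v(1) by (rule integrable_funpow)
    show "(\<lambda>x. v ((r ^^ k) x)) \<in> borel_measurable (F k)" by (rule funpow_measurable_F) measurable
    fix A assume "A \<in> sets (F k)"
    then obtain C where A: "A = (r ^^ k) -` C \<inter> space \<rho>" and [measurable]: "C \<in> sets \<rho>"
      by (auto simp: sets_F)
    have *: "(\<integral>x\<in>A. w x \<partial>\<rho>) = enn2real (\<integral>\<^sup>+x. ennreal (w x) * indicator C ((r ^^ k) x) \<partial>\<rho>)"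
      if [measurable]: "w \<in> borel_measurable \<rho>" and "\<And>x. 0 \<le> w x" for w :: "'a \<Rightarrow> real"
    proof -
      have "(\<integral>x\<in>A. w x \<partial>\<rho>) = (\<integral>x. w x * indicator C ((r ^^ k) x) \<partial>\<rho>)"
        unfolding set_lebesgue_integral_def A
        by (intro Bochner_Integration.integral_cong) (auto simp: indicator_def)
      also have "\<dots> = enn2real (\<integral>\<^sup>+x. ennreal (w x * indicator C ((r ^^ k) x)) \<partial>\<rho>)"
        using that by (intro integral_eq_nn_integral) auto
      also have "\<dots> = enn2real (\<integral>\<^sup>+x. ennreal (w x) * indicator C ((r ^^ k) x) \<partial>\<rho>)"
        by (intro arg_cong[where f = enn2real] nn_integral_cong) (auto simp: indicator_def)
      finally show ?thesis .
    qed
    have "(\<integral>\<^sup>+x. ennreal (v ((r ^^ k) x)) * indicator C ((r ^^ k) x) \<partial>\<rho>)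
        = (\<integral>\<^sup>+x. ennreal (v x) * indicator C x \<partial>\<rho>)"
      by (rule invariant_funpow[of "\<lambda>x. ennreal (v x) * indicator C x"]) measurable
    then show "(\<integral>x\<in>A. u x \<partial>\<rho>) = (\<integral>x\<in>A. v ((r ^^ k) x) \<partial>\<rho>)"
      using u v transfer[of "indicator C"] by (subst (1 2) *) auto
  qed (use u in auto)
qed

end

section \<open>Endomorphisms with trivial tail algebra\<close>

text \<open>Exactness of r in the sense of Rokhlin, phrased through functions measurable for every
  \<open>F n\<close>.\<close>

locale exact_harmonic_weight = harmonic_weight +
  assumes exact: "\<And>v::'a \<Rightarrow> real. (\<And>n. v \<in> borel_measurable (F n)) \<Longrightarrow> integrable \<rho> v
      \<Longrightarrow> \<exists>c. AE x in \<rho>. v x = c"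
begin

section \<open>Limit theorems from exactness\<close>

lemma cond_exp_F_tendsto:
  assumes "integrable \<rho> u"
  shows "(\<lambda>k. expectation (\<lambda>x. \<bar>real_cond_exp \<rho> (F k) u x - expectation u\<bar>)) \<longlonglongrightarrow> 0"
  by (rule cond_exp_tendsto_trivial_tail[OF subalgebra_F subalgebra_F_mono exact assms])

text \<open>Composing with \<open>r ^^ k\<close> preserves the \<open>L^1\<close> distance of
  \<open>v k\<close> to a constant, by invariance, and turns \<open>v k\<close> into the conditional
  expectation of u onto \<open>F k\<close>.\<close>

lemma transferred_tendsto:
  assumes u: "integrable \<rho> u" "\<And>x. 0 \<le> u x"
    and v: "\<And>k. integrable \<rho> (v k)" "\<And>k x. 0 \<le> v k x"
    and transfer: "\<And>k \<phi>. \<phi> \<in> borel_measurable \<rho> \<Longrightarrow>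
      (\<integral>\<^sup>+x. ennreal (u x) * \<phi> ((r ^^ k) x) \<partial>\<rho>) = (\<integral>\<^sup>+x. ennreal (v k x) * \<phi> x \<partial>\<rho>)"
  shows "(\<lambda>k. expectation (\<lambda>x. \<bar>v k x - expectation u\<bar>)) \<longlonglongrightarrow> 0"
proof -
  have "expectation (\<lambda>x. \<bar>v k x - expectation u\<bar>)
      = expectation (\<lambda>x. \<bar>real_cond_exp \<rho> (F k) u x - expectation u\<bar>)" for k
  proof -
    have [measurable]: "v k \<in> borel_measurable \<rho>" using v by auto
    have [measurable]: "real_cond_exp \<rho> (F k) u \<in> borel_measurable \<rho>" by simp
    have "expectation (\<lambda>x. \<bar>v k x - expectation u\<bar>) = expectation (\<lambda>x. \<bar>v k ((r ^^ k) x) - expectation u\<bar>)"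
      by (rule expectation_funpow[symmetric]) auto
    also have "\<dots> = expectation (\<lambda>x. \<bar>real_cond_exp \<rho> (F k) u x - expectation u\<bar>)"
    proof (rule integral_cong_AE)
      show "AE x in \<rho>. \<bar>v k ((r ^^ k) x) - expectation u\<bar> = \<bar>real_cond_exp \<rho> (F k) u x - expectation u\<bar>"
        using cond_exp_F_eq[OF u v[of k] transfer] by auto
    qed measurable
    finally show ?thesis .
  qed
  then show ?thesis using cond_exp_F_tendsto[OF u(1)] by simp
qed

text \<open>The function h composed with \<open>r ^^ k\<close> is \<open>F k\<close>-measurable, so
  D may be replaced by its conditional expectation, which tends to the mean of D in
  \<open>L^1\<close>; boundedness of h controls the error.\<close>

lemma mixing:
  assumes D: "integrable \<rho> D"
  shows "(\<lambda>k. expectation (\<lambda>x. h ((r ^^ k) x) * D x)) \<longlonglongrightarrow> expectation h * expectation D"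
proof -
  obtain B where B: "AE x in \<rho>. h x \<le> B" using h_bounded by blast
  have hB: "AE x in \<rho>. norm (h ((r ^^ k) x)) \<le> B" for k
    using AE_funpow[OF B, of k] by simp
  have hi: "integrable \<rho> h" by (rule integrable_const_bound[of _ B]) (use B in auto)
  have mul: "integrable \<rho> (\<lambda>x. h ((r ^^ k) x) * w x)" if w: "integrable \<rho> w" for k and w :: "'a \<Rightarrow> real"
  proof (rule Bochner_Integration.integrable_bound)
    show "integrable \<rho> (\<lambda>x. B * w x)" using w by simp
    show "AE x in \<rho>. norm (h ((r ^^ k) x) * w x) \<le> norm (B * w x)"
      using hB[of k] by eventually_elim (auto simp: abs_mult intro!: mult_right_mono)
    show "(\<lambda>x. h ((r ^^ k) x) * w x) \<in> borel_measurable \<rho>"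
      using w by (intro borel_measurable_times) auto
  qed
  have "norm (expectation (\<lambda>x. h ((r ^^ k) x) * D x) - expectation h * expectation D)
      \<le> expectation (\<lambda>x. \<bar>real_cond_exp \<rho> (F k) D x - expectation D\<bar>) * B" for k
  proof -
    interpret sigma_finite_subalgebra \<rho> "F k" by (rule sigma_finite_subalgebra_prob[OF subalgebra_F])
    have hF: "(\<lambda>x. h ((r ^^ k) x)) \<in> borel_measurable (F k)" by (rule funpow_measurable_F[OF h])
    let ?E = "real_cond_exp \<rho> (F k) D"
    have Ei: "integrable \<rho> ?E" using D by (rule real_cond_exp_int)
    have hk: "integrable \<rho> (\<lambda>x. h ((r ^^ k) x))" by (rule integrable_funpow[OF hi])
    have "expectation (\<lambda>x. h ((r ^^ k) x) * D x) = expectation (\<lambda>x. h ((r ^^ k) x) * ?E x)"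
      using D by (intro real_cond_exp_intg(2)[symmetric] mul hF) auto
    moreover have "expectation h * expectation D = expectation (\<lambda>x. h ((r ^^ k) x) * expectation D)"
      using hk by (simp add: expectation_funpow)
    ultimately have "expectation (\<lambda>x. h ((r ^^ k) x) * D x) - expectation h * expectation D
        = expectation (\<lambda>x. h ((r ^^ k) x) * (?E x - expectation D))"
      using mul[OF Ei] hk by (simp add: right_diff_distrib)
    also have "norm \<dots> \<le> expectation (\<lambda>x. norm (h ((r ^^ k) x) * (?E x - expectation D)))"
      by (rule integral_norm_bound)
    also have "\<dots> \<le> expectation (\<lambda>x. B * \<bar>?E x - expectation D\<bar>)"
    proof (rule integral_mono_AE)
      show "integrable \<rho> (\<lambda>x. norm (h ((r ^^ k) x) * (?E x - expectation D)))"
        using Ei by (intro integrable_norm mul) auto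
      show "AE x in \<rho>. norm (h ((r ^^ k) x) * (?E x - expectation D)) \<le> B * \<bar>?E x - expectation D\<bar>"
        using hB[of k] by eventually_elim (auto simp: abs_mult intro!: mult_right_mono)
    qed (use Ei in auto)
    finally show ?thesis by (simp add: mult.commute)
  qed
  then have "(\<lambda>k. expectation (\<lambda>x. h ((r ^^ k) x) * D x) - expectation h * expectation D) \<longlonglongrightarrow> 0"
    by (intro tendsto_0_le[OF cond_exp_F_tendsto[OF D], of _ B] always_eventually allI) simp
  then show ?thesis by (simp add: LIM_zero_iff)
qed

section \<open>Energy densities of functions in the intersection of the ranges\<close>

abbreviation "energy f x \<equiv> (norm (f x))\<^sup>2 * h x"

text \<open>The difference factors as the energy of \<open>T^k 1\<close> times
  \<open>energy g - c\<close> evaluated at \<open>(r ^^ k) x\<close>. Iterated harmonicity for the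
  constant function 1 turns the first factor into the weight h, which is at most B.\<close>

lemma energy_asymptotics:
  assumes f: "f \<in> L2_fun M" and g: "g \<in> L2_fun M" and fg: "AE x in M. f x = (T ^^ k) g x"
    and B: "AE x in \<rho>. h x \<le> B"
  shows "(\<integral>\<^sup>+x. ennreal \<bar>energy f x * h ((r ^^ k) x) - c * energy ((T ^^ k) (\<lambda>_. 1)) x\<bar> \<partial>\<rho>)
    \<le> ennreal (B * expectation (\<lambda>x. \<bar>energy g x - c\<bar>))"
proof -
  have fm[measurable]: "f \<in> borel_measurable \<rho>" "g \<in> borel_measurable \<rho>"
    and gi: "integrable \<rho> (energy g)" using f g by (auto simp: L2_fun_M)
  have "(\<integral>\<^sup>+x. ennreal \<bar>energy f x * h ((r ^^ k) x) - c * energy ((T ^^ k) (\<lambda>_. 1)) x\<bar> \<partial>\<rho>)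
      = (\<integral>\<^sup>+x. ennreal (energy ((T ^^ k) (\<lambda>_. 1)) x) * ennreal \<bar>energy g ((r ^^ k) x) - c\<bar> \<partial>\<rho>)"
  proof (rule nn_integral_cong_AE)
    show "AE x in \<rho>. ennreal \<bar>energy f x * h ((r ^^ k) x) - c * energy ((T ^^ k) (\<lambda>_. 1)) x\<bar>
        = ennreal (energy ((T ^^ k) (\<lambda>_. 1)) x) * ennreal \<bar>energy g ((r ^^ k) x) - c\<bar>"
      using fg[unfolded AE_M]
    proof eventually_elim
      case (elim x)
      have "energy f x = energy ((T ^^ k) (\<lambda>_. 1)) x * (norm (g ((r ^^ k) x)))\<^sup>2"
      \<comment> \<open>Equality modulo M says nothing where h vanishes, but both energies are zero
        there.\<close>
      proof (cases "h x = 0")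
        case False
        then have "f x = (T ^^ k) g x" using elim h_nonneg[of x] by (simp add: less_le)
        then show ?thesis using T_funpow_eq[of k g x] by (simp add: norm_mult power_mult_distrib)
      qed simp
      then have "energy f x * h ((r ^^ k) x) - c * energy ((T ^^ k) (\<lambda>_. 1)) x
          = energy ((T ^^ k) (\<lambda>_. 1)) x * (energy g ((r ^^ k) x) - c)"
        by (auto simp: algebra_simps)
      then show ?case by (simp add: abs_mult ennreal_mult)
    qed
  qed
  also have "\<dots> = (\<integral>\<^sup>+x. ennreal ((norm (1::complex))\<^sup>2 * h x) * ennreal \<bar>energy g x - c\<bar> \<partial>\<rho>)"
    by (rule harmonic_T_funpow[where g = "\<lambda>_. 1" and \<phi> = "\<lambda>x. ennreal \<bar>energy g x - c\<bar>"]) measurable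
  also have "\<dots> \<le> (\<integral>\<^sup>+x. ennreal (B * \<bar>energy g x - c\<bar>) \<partial>\<rho>)"
    using B by (intro nn_integral_mono_AE, eventually_elim)
      (auto simp: ennreal_mult[symmetric] intro!: ennreal_leI mult_right_mono)
  also have "\<dots> = ennreal (expectation (\<lambda>x. B * \<bar>energy g x - c\<bar>))"
  proof (rule nn_integral_eq_integral)
    show "AE x in \<rho>. 0 \<le> B * \<bar>energy g x - c\<bar>"
      using B
    proof eventually_elim
      case (elim x)
      then have "0 \<le> B" using h_nonneg[of x] by linarith
      then show ?case by simp
    qed
  qed (use gi in auto)
  finally show ?thesis by simp
qed

text \<open>Iterated harmonicity makes \<open>energy (g k)\<close> the transfer of
  \<open>energy f\<close> under \<open>r ^^ k\<close>.\<close>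

lemma energy_tendsto:
  assumes f: "f \<in> L2_fun M" and g: "\<And>k. g k \<in> L2_fun M" and fg: "\<And>k. AE x in M. f x = (T ^^ k) (g k) x"
  shows "(\<lambda>k. expectation (\<lambda>x. \<bar>energy (g k) x - expectation (energy f)\<bar>)) \<longlonglongrightarrow> 0"
proof (rule transferred_tendsto)
  fix k and \<phi> :: "'a \<Rightarrow> ennreal" assume [measurable]: "\<phi> \<in> borel_measurable \<rho>"
  have "(\<integral>\<^sup>+x. ennreal (energy f x) * \<phi> ((r ^^ k) x) \<partial>\<rho>)
      = (\<integral>\<^sup>+x. ennreal (energy ((T ^^ k) (g k)) x) * \<phi> ((r ^^ k) x) \<partial>\<rho>)"
  proof (rule nn_integral_cong_AE)
    show "AE x in \<rho>. ennreal (energy f x) * \<phi> ((r ^^ k) x)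
        = ennreal (energy ((T ^^ k) (g k)) x) * \<phi> ((r ^^ k) x)"
      using fg[of k, unfolded AE_M]
    proof eventually_elim
      case (elim x)
      then show ?case using h_nonneg[of x] by (cases "h x = 0") (auto simp: less_le)
    qed
  qed
  also have "\<dots> = (\<integral>\<^sup>+x. ennreal (energy (g k) x) * \<phi> x \<partial>\<rho>)"
    by (rule harmonic_T_funpow) (use g in \<open>auto simp: L2_fun_M\<close>)
  finally show "(\<integral>\<^sup>+x. ennreal (energy f x) * \<phi> ((r ^^ k) x) \<partial>\<rho>)
    = (\<integral>\<^sup>+x. ennreal (energy (g k) x) * \<phi> x \<partial>\<rho>)" .
qed (use f g in \<open>auto simp: L2_fun_M\<close>)

definition tail_fun :: "('a \<Rightarrow> complex) \<Rightarrow> bool" where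
  "tail_fun f \<longleftrightarrow> f \<in> L2_fun M \<and> (\<forall>k. \<exists>g\<in>L2_fun M. AE x in M. f x = (T ^^ k) g x)"

lemma tail_funE:
  assumes "tail_fun f"
  obtains g where "\<forall>k. g k \<in> L2_fun M \<and> (AE x in M. f x = (T ^^ k) (g k) x)"
proof -
  have "\<forall>k. \<exists>g. g \<in> L2_fun M \<and> (AE x in M. f x = (T ^^ k) g x)"
    using assms unfolding tail_fun_def by blast
  from choice[OF this] show thesis by (elim exE) (rule that)
qed

text \<open>Multiplied by h composed with \<open>r ^^ k\<close>, both energies approach the same
  multiple of the energy of \<open>T^k 1\<close>. Their difference times that factor thus tends to 0
  in \<open>L^1\<close>, while by mixing its integral tends to a product with the positive mean of
  h.\<close>

lemma tail_fun_energy_unique: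
  assumes f: "tail_fun f" and f': "tail_fun f'"
    and c: "expectation (energy f) = expectation (energy f')"
    and pos: "0 < expectation h"
  shows "AE x in \<rho>. energy f x = energy f' x"
proof -
  obtain g where "\<forall>k. g k \<in> L2_fun M \<and> (AE x in M. f x = (T ^^ k) (g k) x)"
    by (rule tail_funE[OF f])
  then have g: "g k \<in> L2_fun M" "AE x in M. f x = (T ^^ k) (g k) x" for k by auto
  obtain g' where "\<forall>k. g' k \<in> L2_fun M \<and> (AE x in M. f' x = (T ^^ k) (g' k) x)"
    by (rule tail_funE[OF f'])
  then have g': "g' k \<in> L2_fun M" "AE x in M. f' x = (T ^^ k) (g' k) x" for k by auto
  have L: "f \<in> L2_fun M" "f' \<in> L2_fun M" using f f' by (auto simp: tail_fun_def)
  then have [measurable]: "f \<in> borel_measurable \<rho>" "f' \<in> borel_measurable \<rho>"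
    and i: "integrable \<rho> (energy f)" "integrable \<rho> (energy f')" by (auto simp: L2_fun_M)
  obtain B where B: "AE x in \<rho>. h x \<le> B" using h_bounded by blast
  let ?c = "expectation (energy f)"
  let ?D = "\<lambda>x. \<bar>energy f x - energy f' x\<bar>"
  define \<epsilon> where "\<epsilon> k = B * expectation (\<lambda>x. \<bar>energy (g k) x - ?c\<bar>)
    + B * expectation (\<lambda>x. \<bar>energy (g' k) x - ?c\<bar>)" for k
  have "\<epsilon> \<longlonglongrightarrow> B * 0 + B * 0"
    unfolding \<epsilon>_def using energy_tendsto[OF L(1) g] energy_tendsto[OF L(2) g'] c
    by (intro tendsto_intros) auto
  then have \<epsilon>0: "\<epsilon> \<longlonglongrightarrow> 0" by simp
  have B0: "0 \<le> B"
  proof -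
    have "AE x in \<rho>. 0 \<le> B" using B by eventually_elim (rule order_trans[OF h_nonneg])
    then show ?thesis by simp
  qed
  have "expectation (\<lambda>x. h ((r ^^ k) x) * ?D x) \<le> \<epsilon> k" for k
  proof -
    let ?w = "energy ((T ^^ k) (\<lambda>_. 1))"
    have "(\<integral>\<^sup>+x. ennreal (h ((r ^^ k) x) * ?D x) \<partial>\<rho>)
        \<le> (\<integral>\<^sup>+x. ennreal \<bar>energy f x * h ((r ^^ k) x) - ?c * ?w x\<bar>
            + ennreal \<bar>energy f' x * h ((r ^^ k) x) - ?c * ?w x\<bar> \<partial>\<rho>)"
    proof (rule nn_integral_mono)
      fix x
      have "h ((r ^^ k) x) * ?D x = \<bar>(energy f x * h ((r ^^ k) x) - ?c * ?w x)
          - (energy f' x * h ((r ^^ k) x) - ?c * ?w x)\<bar>"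
      proof -
        have "(energy f x * h ((r ^^ k) x) - ?c * ?w x) - (energy f' x * h ((r ^^ k) x) - ?c * ?w x)
            = h ((r ^^ k) x) * (energy f x - energy f' x)"
          by (simp only: right_diff_distrib mult.commute diff_diff_eq2 diff_add_cancel)
        then show ?thesis by (simp only: abs_mult abs_of_nonneg[OF h_nonneg])
      qed
      also have "\<dots> \<le> \<bar>energy f x * h ((r ^^ k) x) - ?c * ?w x\<bar> + \<bar>energy f' x * h ((r ^^ k) x) - ?c * ?w x\<bar>"
        by (rule abs_triangle_ineq4)
      finally have "h ((r ^^ k) x) * ?D x \<le> \<dots>" .
      from ennreal_leI[OF this] show "ennreal (h ((r ^^ k) x) * ?D x) \<le> ennreal \<bar>energy f x * h ((r ^^ k) x) - ?c * ?w x\<bar>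
            + ennreal \<bar>energy f' x * h ((r ^^ k) x) - ?c * ?w x\<bar>"
        by (simp only: ennreal_plus[OF abs_ge_zero abs_ge_zero])
    qed
    also have "\<dots> = (\<integral>\<^sup>+x. ennreal \<bar>energy f x * h ((r ^^ k) x) - ?c * ?w x\<bar> \<partial>\<rho>)
            + (\<integral>\<^sup>+x. ennreal \<bar>energy f' x * h ((r ^^ k) x) - ?c * ?w x\<bar> \<partial>\<rho>)"
      by (rule nn_integral_add) measurable
    also have "\<dots> \<le> ennreal (B * expectation (\<lambda>x. \<bar>energy (g k) x - ?c\<bar>))
        + ennreal (B * expectation (\<lambda>x. \<bar>energy (g' k) x - ?c\<bar>))"
      by (intro add_mono energy_asymptotics L g g' B)
    also have "\<dots> = ennreal (\<epsilon> k)"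
      unfolding \<epsilon>_def using B0 by (subst ennreal_plus) auto
    finally have "(\<integral>\<^sup>+x. ennreal (h ((r ^^ k) x) * ?D x) \<partial>\<rho>) \<le> ennreal (\<epsilon> k)" .
    then show ?thesis
      using B0 by (subst integral_eq_nn_integral) (auto intro!: enn2real_leI simp: \<epsilon>_def)
  qed
  \<comment> \<open>The left side is the mixing limit of quantities bounded by
    \<open>\<epsilon> k\<close>.\<close>
  then have "expectation h * expectation ?D \<le> 0"
    using i by (intro LIMSEQ_le[OF mixing \<epsilon>0]) auto
  then have "expectation ?D \<le> 0"
    using pos by (simp add: mult_le_0_iff)
  moreover have "0 \<le> expectation ?D" by simp
  ultimately have "expectation ?D = 0" by simp
  then have "AE x in \<rho>. ?D x = 0"
    using i by (subst (asm) integral_nonneg_eq_0_iff_AE) auto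
  then show ?thesis by eventually_elim simp
qed

text \<open>Injectivity of T cancels one factor from the representation of f by
  \<open>T ^^ Suc k\<close>.\<close>

lemma tail_fun_preimage:
  assumes f: "tail_fun f" and f': "f' \<in> L2_fun M" and Tf: "AE x in M. f x = T f' x"
  shows "tail_fun f'"
  unfolding tail_fun_def
proof (intro conjI allI f')
  fix k
  obtain g where g: "g \<in> L2_fun M" "AE x in M. f x = (T ^^ Suc k) g x"
    using f unfolding tail_fun_def by blast
  have "AE x in M. T f' x = T ((T ^^ k) g) x"
    using Tf g(2) by eventually_elim simp
  then have "AE x in M. f' x = (T ^^ k) g x"
    by (subst (asm) T_AE_eq_iff) (use f' g in \<open>auto simp: L2_fun_M\<close>)
  then show "\<exists>g\<in>L2_fun M. AE x in M. f' x = (T ^^ k) g x" using g by blast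
qed

text \<open>T preserves the total energy, so uniqueness of the energy for a given total applies to f
  and its preimage.\<close>

lemma tail_fun_preimage_energy:
  assumes f: "tail_fun f" and f': "f' \<in> L2_fun M" and Tf: "AE x in M. f x = T f' x"
    and pos: "0 < expectation h"
  shows "AE x in \<rho>. energy f' x = energy f x"
proof -
  have [measurable]: "f \<in> borel_measurable \<rho>" "f' \<in> borel_measurable \<rho>"
    using f f' by (auto simp: tail_fun_def L2_fun_M)
  have "(\<integral>\<^sup>+x. ennreal (energy f x) \<partial>\<rho>) = (\<integral>\<^sup>+x. ennreal (energy (T f') x) \<partial>\<rho>)"
  proof (rule nn_integral_cong_AE)
    show "AE x in \<rho>. ennreal (energy f x) = ennreal (energy (T f') x)"
      using Tf[unfolded AE_M]
    proof eventually_elim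
      case (elim x)
      then show ?case using h_nonneg[of x] by (cases "h x = 0") (auto simp: less_le)
    qed
  qed
  also have "\<dots> = (\<integral>\<^sup>+x. ennreal (energy f' x) \<partial>\<rho>)" by (rule T_norm) measurable
  finally have "expectation (energy f') = expectation (energy f)"
    by (simp add: integral_eq_nn_integral)
  with tail_fun_energy_unique[OF tail_fun_preimage[OF f f' Tf] f _ pos] show ?thesis by simp
qed

text \<open>The preimage f' has the energy of f, and its energy is also the push-forward of that of
  f under r. So \<open>energy f\<close> is its own transfer for every k, and the limit theorem
  concerns a constant sequence.\<close>

lemma tail_fun_energy_const:
  assumes f: "tail_fun f" and pos: "0 < expectation h"
  shows "AE x in \<rho>. energy f x = expectation (energy f)"
proof -
  have fm[measurable]: "f \<in> borel_measurable \<rho>" and i: "integrable \<rho> (energy f)"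
    using f by (auto simp: tail_fun_def L2_fun_M)
  obtain f' where f': "f' \<in> L2_fun M" "AE x in M. f x = (T ^^ 1) f' x"
    using f unfolding tail_fun_def by blast
  have fm'[measurable]: "f' \<in> borel_measurable \<rho>" using f' by (auto simp: L2_fun_M)
  have e: "AE x in \<rho>. energy f' x = energy f x"
    using tail_fun_preimage_energy[OF f f'(1) _ pos] f'(2) by simp
  \<comment> \<open>The measure with density \<open>energy f\<close> is r-invariant.\<close>
  have step: "(\<integral>\<^sup>+x. ennreal (energy f x) * \<phi> (r x) \<partial>\<rho>) = (\<integral>\<^sup>+x. ennreal (energy f x) * \<phi> x \<partial>\<rho>)"
    if [measurable]: "\<phi> \<in> borel_measurable \<rho>" for \<phi> :: "'a \<Rightarrow> ennreal"
  proof -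
    have "(\<integral>\<^sup>+x. ennreal (energy f x) * \<phi> (r x) \<partial>\<rho>) = (\<integral>\<^sup>+x. ennreal (energy ((T ^^ 1) f') x) * \<phi> ((r ^^ 1) x) \<partial>\<rho>)"
    proof (rule nn_integral_cong_AE)
      show "AE x in \<rho>. ennreal (energy f x) * \<phi> (r x) = ennreal (energy ((T ^^ 1) f') x) * \<phi> ((r ^^ 1) x)"
        using f'(2)[unfolded AE_M]
      proof eventually_elim
        case (elim x)
        then show ?case using h_nonneg[of x] by (cases "h x = 0") (auto simp: less_le)
      qed
    qed
    also have "\<dots> = (\<integral>\<^sup>+x. ennreal (energy f' x) * \<phi> x \<partial>\<rho>)"
      by (rule harmonic_T_funpow[OF fm' that])
    also have "\<dots> = (\<integral>\<^sup>+x. ennreal (energy f x) * \<phi> x \<partial>\<rho>)"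
    proof (rule nn_integral_cong_AE)
      show "AE x in \<rho>. ennreal (energy f' x) * \<phi> x = ennreal (energy f x) * \<phi> x"
        using e by eventually_elim (simp only:)
    qed
    finally show ?thesis .
  qed
  have "(\<integral>\<^sup>+x. ennreal (energy f x) * \<phi> ((r ^^ k) x) \<partial>\<rho>) = (\<integral>\<^sup>+x. ennreal (energy f x) * \<phi> x \<partial>\<rho>)"
    if "\<phi> \<in> borel_measurable \<rho>" for k and \<phi> :: "'a \<Rightarrow> ennreal"
  proof (induction k)
    case (Suc k)
    have "(\<lambda>x. \<phi> ((r ^^ k) x)) \<in> borel_measurable \<rho>" by (rule measurable_compose[OF r_funpow that])
    from step[OF this] show ?case using Suc by (simp add: funpow_swap1[of r])
  qed simp
  then have "(\<lambda>k::nat. expectation (\<lambda>x. \<bar>energy f x - expectation (energy f)\<bar>)) \<longlonglongrightarrow> 0"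
    using i by (intro transferred_tendsto) auto
  then have "expectation (\<lambda>x. \<bar>energy f x - expectation (energy f)\<bar>) = 0"
    by (simp add: LIMSEQ_const_iff)
  then have "AE x in \<rho>. \<bar>energy f x - expectation (energy f)\<bar> = 0"
    using i by (subst (asm) integral_nonneg_eq_0_iff_AE) auto
  then show ?thesis by eventually_elim simp
qed

text \<open>The weight \<open>s = \<bar>m\<bar>\<^sup>2\<close> has mean \<open>1\<close> over fibres and satisfies \<open>a = s h\<close> with \<open>a = h \<circ> r\<close>, so
  \<open>s / (s + a) = 1 / (1 + h)\<close> and \<open>1 / (1 + a)\<close> have the same integral; strict concavity of
  \<open>s \<mapsto> s / (s + a)\<close> then forces \<open>s = 1\<close>.\<close>

lemma tail_fun_nonzero_imp_unimodular:
  assumes f: "tail_fun f" and nz: "\<not> (AE x in M. f x = 0)"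
    and normalized: "\<And>\<phi>::'a \<Rightarrow> ennreal. \<phi> \<in> borel_measurable \<rho> \<Longrightarrow>
      (\<integral>\<^sup>+x. ennreal ((norm (m x))\<^sup>2) * \<phi> (r x) \<partial>\<rho>) = (\<integral>\<^sup>+x. \<phi> x \<partial>\<rho>)"
  shows "AE x in \<rho>. norm (m x) = 1"
proof -
  have fm[measurable]: "f \<in> borel_measurable \<rho>" and i: "integrable \<rho> (energy f)"
    using f by (auto simp: tail_fun_def L2_fun_M)
  obtain B where B: "AE x in \<rho>. h x \<le> B" using h_bounded by blast
  have hi: "integrable \<rho> h" by (rule integrable_const_bound[of _ B]) (use B in auto)
  \<comment> \<open>If h had mean 0, M would be the null measure and f would vanish M-almost
    everywhere.\<close>
  have pos: "0 < expectation h"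
  proof (rule ccontr)
    assume "\<not> ?thesis"
    then have "expectation h = 0" using Bochner_Integration.integral_nonneg[of \<rho> h] by (auto simp: not_less intro!: antisym)
    then have "AE x in \<rho>. h x = 0" using hi by (subst (asm) integral_nonneg_eq_0_iff_AE) auto
    then have "AE x in M. f x = 0" unfolding AE_M by eventually_elim simp
    with nz show False by simp
  qed
  define c where "c = expectation (energy f)"
  have cf: "AE x in \<rho>. energy f x = c" unfolding c_def by (rule tail_fun_energy_const[OF f pos])
  have "c \<noteq> 0"
  proof
    assume "c = 0"
    then have "AE x in M. f x = 0" unfolding AE_M using cf[unfolded \<open>c = 0\<close>] by eventually_elim auto
    with nz show False by simp
  qed
  then have c0: "0 < c" unfolding c_def using Bochner_Integration.integral_nonneg[of \<rho> "energy f"] by (simp add: less_le)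
  obtain f' where f': "f' \<in> L2_fun M" and "AE x in M. f x = (T ^^ 1) f' x"
    using f unfolding tail_fun_def by blast
  then have Tf': "AE x in M. f x = T f' x" by simp
  have fm'[measurable]: "f' \<in> borel_measurable \<rho>" using f' by (auto simp: L2_fun_M)
  have cf': "AE x in \<rho>. energy f' x = c"
    using tail_fun_preimage_energy[OF f f' Tf' pos] cf by eventually_elim simp
  have "AE x in \<rho>. energy f' ((r ^^ 1) x) = c" by (rule AE_funpow[OF cf']) measurable
  \<comment> \<open>The energies of f at x and of f' at \<open>r x\<close> both equal c > 0. Hence
    both weights are positive, and cancelling \<open>|f'(r x)|^2\<close> yields the
    relation.\<close>
  then have rel: "AE x in \<rho>. 0 < h x \<and> 0 < h (r x) \<and> h (r x) = (norm (m x))\<^sup>2 * h x"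
    using cf Tf'[unfolded AE_M]
  proof eventually_elim
    case (elim x)
    then have e': "energy f' (r x) = c" by simp
    have hx: "0 < h x" using elim c0 h_nonneg[of x] by (auto simp: less_le)
    have hrx: "0 < h (r x)" using e' c0 h_nonneg[of "r x"] by (auto simp: less_le)
    have "c = (norm (m x))\<^sup>2 * (norm (f' (r x)))\<^sup>2 * h x"
      using elim hx by (simp add: T_def norm_mult power_mult_distrib)
    then have "(norm (f' (r x)))\<^sup>2 * h (r x) = (norm (f' (r x)))\<^sup>2 * ((norm (m x))\<^sup>2 * h x)"
      using e' by (simp add: mult_ac)
    moreover have "(norm (f' (r x)))\<^sup>2 \<noteq> 0" using e' c0 by auto
    ultimately show ?case using hx hrx by simp
  qed
  let ?s = "\<lambda>x. (norm (m x))\<^sup>2" and ?a = "\<lambda>x. h (r x)"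
  \<comment> \<open>At \<open>r x\<close> this is \<open>a / (1 + a)^2\<close>, the slope of
    \<open>s / (s + a)\<close> at s = 1.\<close>
  define \<psi> where "\<psi> x = h x / (1 + h x)\<^sup>2" for x
  have [measurable]: "\<psi> \<in> borel_measurable \<rho>" unfolding \<psi>_def by measurable
  have a1: "0 < 1 + h x" for x using h_nonneg[of x] by linarith
  have \<psi>1: "0 \<le> \<psi> x" "\<psi> x \<le> 1" for x
  proof -
    have "h x \<le> (1 + h x)\<^sup>2" by (simp add: power2_eq_square algebra_simps)
    then show "0 \<le> \<psi> x" "\<psi> x \<le> 1" using a1[of x] by (auto simp: \<psi>_def divide_le_eq_1)
  qed
  have \<psi>i: "integrable \<rho> \<psi>" by (rule integrable_const_bound[of _ 1]) (use \<psi>1 in auto)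
  have nn: "(\<integral>\<^sup>+x. ennreal (?s x * \<psi> (r x)) \<partial>\<rho>) = (\<integral>\<^sup>+x. ennreal (\<psi> x) \<partial>\<rho>)"
    using normalized[of "\<lambda>x. ennreal (\<psi> x)"] \<psi>1 by (simp add: ennreal_mult)
  have s\<psi>i: "integrable \<rho> (\<lambda>x. ?s x * \<psi> (r x))"
    using nn \<psi>i \<psi>1 by (auto simp: integrable_iff_bounded)
  have r\<psi>i: "integrable \<rho> (\<lambda>x. \<psi> (r x))" using integrable_funpow[OF \<psi>i, of 1] by simp
  have "expectation (\<lambda>x. ?s x * \<psi> (r x)) = expectation \<psi>"
    using nn \<psi>1 by (simp add: integral_eq_nn_integral)
  moreover have "expectation (\<lambda>x. \<psi> (r x)) = expectation \<psi>"
    using expectation_funpow[of \<psi> 1] \<psi>1 by simp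
  \<comment> \<open>The linear term of the tangent has mean zero, by the normalization of s.\<close>
  ultimately have e1: "expectation (\<lambda>x. ?s x * \<psi> (r x) - \<psi> (r x)) = 0"
    using s\<psi>i r\<psi>i by simp
  have qi: "integrable \<rho> (\<lambda>x. 1 / (1 + h x))"
    by (rule integrable_const_bound[of _ 1]) (use a1 in \<open>auto simp: divide_le_eq_1\<close>)
  have rqi: "integrable \<rho> (\<lambda>x. 1 / (1 + ?a x))" using integrable_funpow[OF qi, of 1] by simp
  have e2: "expectation (\<lambda>x. 1 / (1 + ?a x)) = expectation (\<lambda>x. 1 / (1 + h x))"
    using expectation_funpow[of "\<lambda>x. 1 / (1 + h x)" 1] a1 by (simp add: less_imp_le)
  \<comment> \<open>The tangent at s = 1 minus \<open>s / (s + a)\<close>: almost everywhere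
    nonnegative, and zero only for s = 1. Its mean is zero by \<open>e1\<close> and
    \<open>e2\<close>.\<close>
  define d where "d x = 1 / (1 + ?a x) + (?s x * \<psi> (r x) - \<psi> (r x)) - 1 / (1 + h x)" for x
  have di: "integrable \<rho> d" unfolding d_def using qi rqi s\<psi>i r\<psi>i by auto
  have "expectation d = 0" unfolding d_def using qi rqi s\<psi>i r\<psi>i e1 e2 by simp
  moreover have d_eq: "AE x in \<rho>. d x = ?a x * (?s x - 1)\<^sup>2 / ((1 + ?a x)\<^sup>2 * (?s x + ?a x)) \<and> 0 < ?a x"
    using rel
  proof eventually_elim
    case (elim x)
    then have s0: "0 < ?s x" by (metis mult_zero_left less_irrefl zero_less_power2 power_zero_numeral)
    define s a where "s = ?s x" and "a = ?a x"
    have sa: "0 < s" "0 < a" "h x = a / s"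
      using elim s0 by (auto simp: s_def a_def field_simps)
    have "1 / (1 + h x) = s / (s + a)" unfolding sa(3) using sa(1,2) by (simp add: field_simps)
    moreover have "1 / (1 + a) + (s * (a / (1 + a)\<^sup>2) - a / (1 + a)\<^sup>2) - s / (s + a)
        = a * (s - 1)\<^sup>2 / ((1 + a)\<^sup>2 * (s + a))"
    proof -
      have "1 + a \<noteq> 0" "s + a \<noteq> 0" using sa by auto
      then show ?thesis by (simp add: divide_simps) (simp add: power2_eq_square algebra_simps)
    qed
    ultimately show ?case using elim by (simp add: d_def \<psi>_def s_def a_def)
  qed
  moreover have "AE x in \<rho>. 0 \<le> d x" using d_eq by eventually_elim simp
  ultimately have "AE x in \<rho>. d x = 0"
    using di by (subst (asm) integral_nonneg_eq_0_iff_AE) auto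
  then show ?thesis using d_eq
  proof eventually_elim
    case (elim x)
    have "0 < (1 + ?a x)\<^sup>2 * (?s x + ?a x)" using elim a1[of "r x"] by (intro mult_pos_pos add_nonneg_pos) auto
    then have "(?s x - 1)\<^sup>2 = 0" using elim by auto
    then have "?s x = 1" by simp
    then show ?case by (simp add: power2_eq_1_iff) (use norm_ge_zero[of "m x"] in linarith)
  qed
qed

end

section \<open>The operator on classes\<close>

lemma L2_fun_add:
  assumes f: "f \<in> L2_fun M" and g: "g \<in> L2_fun M"
  shows "(\<lambda>x. f x + g x) \<in> L2_fun M"
proof -
  have [measurable]: "f \<in> borel_measurable M" "g \<in> borel_measurable M"
    and i: "integrable M (\<lambda>x. (norm (f x))\<^sup>2)" "integrable M (\<lambda>x. (norm (g x))\<^sup>2)"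
    using f g by (auto simp: L2_fun_def)
  have "(norm (f x + g x))\<^sup>2 \<le> 2 * (norm (f x))\<^sup>2 + 2 * (norm (g x))\<^sup>2" for x
  proof -
    have "(norm (f x + g x))\<^sup>2 \<le> (norm (f x) + norm (g x))\<^sup>2"
      by (intro power_mono norm_triangle_ineq) auto
    also have "\<dots> \<le> 2 * (norm (f x))\<^sup>2 + 2 * (norm (g x))\<^sup>2"
      using sum_squares_bound[of "norm (f x)" "norm (g x)"] by (simp add: power2_sum)
    finally show ?thesis .
  qed
  then have bound: "norm ((norm (f x + g x))\<^sup>2) \<le> norm (2 * (norm (f x))\<^sup>2 + 2 * (norm (g x))\<^sup>2)" for x
    by (simp only: real_norm_def abs_of_nonneg add_nonneg_nonneg zero_le_power2 mult_nonneg_nonneg zero_le_numeral)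
  have "integrable M (\<lambda>x. (norm (f x + g x))\<^sup>2)"
  proof (rule Bochner_Integration.integrable_bound)
    show "integrable M (\<lambda>x. 2 * (norm (f x))\<^sup>2 + 2 * (norm (g x))\<^sup>2)" using i by simp
    show "(\<lambda>x. (norm (f x + g x))\<^sup>2) \<in> borel_measurable M" by measurable
  qed (rule AE_I2, rule bound)
  then show ?thesis by (simp add: L2_fun_def)
qed

lemma L2_fun_scale: "f \<in> L2_fun M \<Longrightarrow> (\<lambda>x. c * f x) \<in> L2_fun M"
  by (auto simp: L2_fun_def norm_mult power_mult_distrib)

lemma L2_zero_fun: "(\<lambda>_. 0) \<in> L2_fun M"
  by (simp add: L2_fun_def)

lemma L2_class_eq_iff:
  assumes "f \<in> L2_fun M" "g \<in> L2_fun M"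
  shows "L2_class M f = L2_class M g \<longleftrightarrow> (AE x in M. f x = g x)"
  unfolding L2_class_def using assms
  by (subst eq_equiv_class_iff[OF equiv_L2_rel]) (auto simp: L2_rel_def)

lemma in_L2_class_iff:
  "f \<in> L2_fun M \<Longrightarrow> g \<in> L2_class M f \<longleftrightarrow> g \<in> L2_fun M \<and> (AE x in M. f x = g x)"
  by (auto simp: L2_class_def L2_rel_def)

lemma L2_class_self: "f \<in> L2_fun M \<Longrightarrow> f \<in> L2_class M f"
  by (simp add: in_L2_class_iff)

lemma L2_space_iff: "C \<in> L2_space M \<longleftrightarrow> (\<exists>f\<in>L2_fun M. C = L2_class M f)"
  by (auto simp: L2_space_def L2_class_def quotient_def)

lemma L2_add_class:
  assumes "f \<in> L2_fun M" "g \<in> L2_fun M"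
  shows "L2_add M (L2_class M f) (L2_class M g) = L2_class M (\<lambda>x. f x + g x)"
proof -
  have "L2_class M (\<lambda>x. f' x + g' x) = L2_class M (\<lambda>x. f x + g x)"
    if "f' \<in> L2_class M f" "g' \<in> L2_class M g" for f' g'
  proof -
    have "f' \<in> L2_fun M" "g' \<in> L2_fun M" "AE x in M. f x = f' x" "AE x in M. g x = g' x"
      using that assms by (auto simp: in_L2_class_iff)
    then show ?thesis
      using assms by (subst L2_class_eq_iff) (auto intro!: L2_fun_add)
  qed
  then show ?thesis
    unfolding L2_add_def using L2_class_self[OF assms(1)] L2_class_self[OF assms(2)] by blast
qed

lemma L2_scale_class:
  assumes "f \<in> L2_fun M"
  shows "L2_scale M c (L2_class M f) = L2_class M (\<lambda>x. c * f x)"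
proof -
  have "L2_class M (\<lambda>x. c * f' x) = L2_class M (\<lambda>x. c * f x)" if "f' \<in> L2_class M f" for f'
  proof -
    have "f' \<in> L2_fun M" "AE x in M. f' x = f x" using that assms by (auto simp: in_L2_class_iff)
    then show ?thesis
      using assms by (subst L2_class_eq_iff) (auto intro!: L2_fun_scale)
  qed
  then show ?thesis unfolding L2_scale_def using L2_class_self[OF assms] by blast
qed

context harmonic_weight
begin

text \<open>T respects equality almost everywhere, so all members of the union defining
  \<open>S0\<close> are the same class.\<close>

lemma S0_class:
  assumes f: "f \<in> L2_fun M"
  shows "S0 M m r (L2_class M f) = L2_class M (T f)"
proof -
  have "L2_class M (\<lambda>x. m x * g (r x)) = L2_class M (T f)" if "g \<in> L2_class M f" for g
  proof -
    have g: "g \<in> L2_fun M" "AE x in M. g x = f x" using that f by (auto simp: in_L2_class_iff)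
    then have "AE x in M. T g x = T f x" using f by (subst T_AE_eq_iff) (auto simp: L2_fun_M)
    then have "L2_class M (T g) = L2_class M (T f)" using f g by (simp add: L2_class_eq_iff T_L2)
    then show ?thesis by (simp add: T_def[abs_def])
  qed
  then show ?thesis unfolding S0_def using L2_class_self[OF f] by blast
qed

lemma S0_funpow_class: "f \<in> L2_fun M \<Longrightarrow> (S0 M m r ^^ k) (L2_class M f) = L2_class M ((T ^^ k) f)"
  by (induction k) (simp_all add: S0_class T_funpow_L2)

lemma S0_linear_isometry: "linear_isometry_L2 M (S0 M m r)"
  unfolding linear_isometry_L2_def
proof (intro conjI ballI allI)
  fix C assume "C \<in> L2_space M"
  then obtain f where f: "f \<in> L2_fun M" and C: "C = L2_class M f" by (auto simp: L2_space_iff)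
  then show "S0 M m r C \<in> L2_space M" by (auto simp: L2_space_iff S0_class intro: T_L2)
  have "(\<integral>x. (norm (g x))\<^sup>2 \<partial>M) = enn2real (\<integral>\<^sup>+x. ennreal ((norm (g x))\<^sup>2 * h x) \<partial>\<rho>)"
    if "g \<in> L2_fun M" for g
    using that by (subst integral_density) (auto simp: L2_fun_M mult.commute integral_eq_nn_integral)
  then show "L2_norm M (S0 M m r C) = L2_norm M C"
    using f T_L2[OF f] T_norm[of f] by (simp add: C S0_class L2_norm_class L2_fun_M)
  {
    fix c
    have "T (\<lambda>x. c * f x) = (\<lambda>x. c * T f x)" by (simp add: T_def fun_eq_iff)
    then show "S0 M m r (L2_scale M c C) = L2_scale M c (S0 M m r C)"
      using f by (simp add: C L2_scale_class S0_class L2_fun_scale T_L2)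
  }
  fix D assume "D \<in> L2_space M"
  then obtain g where g: "g \<in> L2_fun M" and D: "D = L2_class M g" by (auto simp: L2_space_iff)
  have "T (\<lambda>x. f x + g x) = (\<lambda>x. T f x + T g x)" by (simp add: T_def fun_eq_iff distrib_left)
  then show "S0 M m r (L2_add M C D) = L2_add M (S0 M m r C) (S0 M m r D)"
    using f g by (simp add: C D L2_add_class S0_class L2_fun_add T_L2)
qed

end

context exact_harmonic_weight
begin

text \<open>A class in the intersection is represented by a \<open>tail_fun\<close>, which would
  force |m| = 1 if it were nonzero.\<close>

lemma S0_pure:
  assumes normalized: "\<And>\<phi>::'a \<Rightarrow> ennreal. \<phi> \<in> borel_measurable \<rho> \<Longrightarrow>
      (\<integral>\<^sup>+x. ennreal ((norm (m x))\<^sup>2) * \<phi> (r x) \<partial>\<rho>) = (\<integral>\<^sup>+x. \<phi> x \<partial>\<rho>)"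
    and m1: "\<not> (AE x in \<rho>. norm (m x) = 1)"
  shows "(\<Inter>k\<in>{1..}. (S0 M m r ^^ k) ` L2_space M) = {L2_zero M}"
proof (intro set_eqI iffI)
  fix C assume "C \<in> {L2_zero M}"
  then have C: "C = L2_class M (\<lambda>_. 0)" by (simp add: L2_zero_def)
  have "(T ^^ k) (\<lambda>_. 0) = (\<lambda>_. 0)" for k
    by (induction k) (auto simp: T_def)
  then have "(S0 M m r ^^ k) C = C" for k unfolding C by (simp add: S0_funpow_class L2_zero_fun)
  moreover have "C \<in> L2_space M" unfolding C by (auto simp: L2_space_iff intro!: L2_zero_fun)
  ultimately show "C \<in> (\<Inter>k\<in>{1..}. (S0 M m r ^^ k) ` L2_space M)"
    by (intro INT_I image_eqI[where x = C]) simp_all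
next
  fix C assume C: "C \<in> (\<Inter>k\<in>{1..}. (S0 M m r ^^ k) ` L2_space M)"
  \<comment> \<open>The intersection starts at k = 1, so membership in \<open>L2_space M\<close>
    comes from the first range; for k = 0 below, f represents itself.\<close>
  then have "C \<in> (S0 M m r ^^ 1) ` L2_space M" by blast
  then have "C \<in> L2_space M"
    using S0_linear_isometry by (auto simp: linear_isometry_L2_def)
  then obtain f where f: "f \<in> L2_fun M" and Cf: "C = L2_class M f" by (auto simp: L2_space_iff)
  have "\<exists>g\<in>L2_fun M. AE x in M. f x = (T ^^ k) g x" for k
  proof (cases "k = 0")
    case False
    then obtain g where "g \<in> L2_fun M" "C = (S0 M m r ^^ k) (L2_class M g)"
      using C by (force simp: L2_space_iff)
    then show ?thesis using f by (auto simp: Cf S0_funpow_class L2_class_eq_iff T_funpow_L2)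
  qed (use f in auto)
  then have "tail_fun f" using f by (simp add: tail_fun_def)
  then have "AE x in M. f x = 0" using tail_fun_nonzero_imp_unimodular[OF _ _ normalized] m1 by blast
  then show "C \<in> {L2_zero M}" using f by (simp add: Cf L2_zero_def L2_class_eq_iff L2_zero_fun)
qed

end

section \<open>Strongly invariant measures\<close>

text \<open>Functions of \<open>r y\<close> are constant on fibres of r and leave the
  average.\<close>

lemma fibre_avg_mult_base:
  fixes q :: "'a \<Rightarrow> real"
  shows "fibre_avg r (\<lambda>y. q y * g (r y)) x = g x * fibre_avg r q x"
proof -
  have "(\<Sum>y\<in>r -` {x}. q y * g (r y)) = g x * (\<Sum>y\<in>r -` {x}. q y)"
    unfolding sum_distrib_left by (intro sum.cong) auto
  then show ?thesis by (simp add: fibre_avg_def)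
qed

text \<open>Strong invariance is stated for complex functions; real ones are embedded and the real
  part is taken.\<close>

lemma strongly_invariant_real:
  fixes f :: "'a \<Rightarrow> real"
  assumes inv: "strongly_invariant \<rho> r" and f: "f \<in> L_infinity \<rho>"
  shows "integrable \<rho> (fibre_avg r f)" "(\<integral>x. f x \<partial>\<rho>) = (\<integral>x. fibre_avg r f x \<partial>\<rho>)"
proof -
  let ?f = "\<lambda>x. complex_of_real (f x)"
  have avg: "fibre_avg r ?f = (\<lambda>x. complex_of_real (fibre_avg r f x))"
    by (simp add: fibre_avg_def fun_eq_iff scaleR_conv_of_real)
  have "?f \<in> L_infinity \<rho>" using f by (auto simp: L_infinity_def)
  then have *: "integrable \<rho> (\<lambda>x. complex_of_real (fibre_avg r f x))"
    "(\<integral>x. complex_of_real (f x) \<partial>\<rho>) = (\<integral>x. complex_of_real (fibre_avg r f x) \<partial>\<rho>)"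
    using inv unfolding strongly_invariant_def avg[symmetric] by auto
  show "integrable \<rho> (fibre_avg r f)" using integrable_Re[OF *(1)] by simp
  show "(\<integral>x. f x \<partial>\<rho>) = (\<integral>x. fibre_avg r f x \<partial>\<rho>)" using *(2) by (simp add: integral_complex_of_real)
qed

text \<open>The claim is that r pushes q d\<rho> to p d\<rho>. On a set A it is strong invariance
  for q times the indicator of A composed with r, which is essentially bounded; equality of measures
  then covers unbounded \<phi>.\<close>

lemma strongly_invariant_nn_integral:
  fixes q p :: "'a \<Rightarrow> real" and \<phi> :: "'a \<Rightarrow> ennreal"
  assumes prob: "prob_space \<rho>" and r[measurable]: "r \<in> \<rho> \<rightarrow>\<^sub>M \<rho>" and inv: "strongly_invariant \<rho> r"
    and q: "q \<in> L_infinity \<rho>" "AE x in \<rho>. 0 \<le> q x"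
    and p: "p \<in> borel_measurable \<rho>" "AE x in \<rho>. 0 \<le> p x"
    and avg: "AE x in \<rho>. fibre_avg r q x = p x"
    and \<phi>[measurable]: "\<phi> \<in> borel_measurable \<rho>"
  shows "(\<integral>\<^sup>+x. ennreal (q x) * \<phi> (r x) \<partial>\<rho>) = (\<integral>\<^sup>+x. ennreal (p x) * \<phi> x \<partial>\<rho>)"
proof -
  interpret prob_space \<rho> by fact
  note [measurable] = p(1)
  obtain B where qm[measurable]: "q \<in> borel_measurable \<rho>" and B: "AE x in \<rho>. norm (q x) \<le> B"
    using q by (auto simp: L_infinity_def)
  have qi: "integrable \<rho> q" by (rule integrable_const_bound[OF B]) measurable
  have avgm[measurable]: "fibre_avg r q \<in> borel_measurable \<rho>"
    using strongly_invariant_real(1)[OF inv q(1)] by auto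
  have pi: "integrable \<rho> p"
    using strongly_invariant_real(1)[OF inv q(1)] avg by (subst integrable_cong_AE[of _ _ "fibre_avg r q"]) auto
  have "distr (density \<rho> (\<lambda>x. ennreal (q x))) \<rho> r = density \<rho> (\<lambda>x. ennreal (p x))"
  proof (rule measure_eqI)
    fix A assume "A \<in> sets (distr (density \<rho> (\<lambda>x. ennreal (q x))) \<rho> r)"
    then have A[measurable]: "A \<in> sets \<rho>" by simp
    have qAB: "AE x in \<rho>. norm (q x * indicator A (r x)) \<le> B"
      using B by eventually_elim (auto simp: indicator_def)
    have qAm: "(\<lambda>x. q x * indicator A (r x)) \<in> borel_measurable \<rho>" by measurable
    have qA: "(\<lambda>x. q x * indicator A (r x)) \<in> L_infinity \<rho>"
      unfolding L_infinity_def using qAB qAm by blast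
    have qAi: "integrable \<rho> (\<lambda>x. q x * indicator A (r x))"
      by (rule integrable_const_bound[OF qAB qAm])
    have pAi: "integrable \<rho> (\<lambda>x. p x * indicator A x)"
      using pi by (rule integrable_real_mult_indicator[OF A])
    have "emeasure (distr (density \<rho> (\<lambda>x. ennreal (q x))) \<rho> r) A
        = (\<integral>\<^sup>+x. ennreal (q x * indicator A (r x)) \<partial>\<rho>)"
      by (subst emeasure_distr, simp, simp, subst emeasure_density)
         (auto intro!: nn_integral_cong simp: indicator_def)
    also have "\<dots> = ennreal (\<integral>x. q x * indicator A (r x) \<partial>\<rho>)"
      using q(2) by (intro nn_integral_eq_integral[OF qAi]) (auto simp: indicator_def)
    also have "(\<integral>x. q x * indicator A (r x) \<partial>\<rho>) = (\<integral>x. indicator A x * fibre_avg r q x \<partial>\<rho>)"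
      using strongly_invariant_real(2)[OF inv qA] by (simp add: fibre_avg_mult_base)
    also have "\<dots> = (\<integral>x. p x * indicator A x \<partial>\<rho>)"
      using avg by (intro integral_cong_AE) auto
    also have "ennreal \<dots> = (\<integral>\<^sup>+x. ennreal (p x * indicator A x) \<partial>\<rho>)"
      using p(2) by (intro nn_integral_eq_integral[OF pAi, symmetric]) (auto simp: indicator_def)
    also have "\<dots> = emeasure (density \<rho> (\<lambda>x. ennreal (p x))) A"
      by (subst emeasure_density) (auto intro!: nn_integral_cong simp: indicator_def)
    finally show "emeasure (distr (density \<rho> (\<lambda>x. ennreal (q x))) \<rho> r) A
      = emeasure (density \<rho> (\<lambda>x. ennreal (p x))) A" .
  qed simp
  then have "(\<integral>\<^sup>+x. \<phi> x \<partial>distr (density \<rho> (\<lambda>x. ennreal (q x))) \<rho> r) = (\<integral>\<^sup>+x. \<phi> x \<partial>density \<rho> (\<lambda>x. ennreal (p x)))"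
    by simp
  then show ?thesis by (simp add: nn_integral_distr nn_integral_density)
qed

lemma averaging_imp_tail_trivial:
  fixes r :: "'a::topological_space \<Rightarrow> 'a" and v :: "'a \<Rightarrow> real"
  assumes avg: "averaging \<rho> r" and \<rho>: "sets \<rho> = sets borel" and r: "r \<in> \<rho> \<rightarrow>\<^sub>M \<rho>"
    and v: "\<And>n. v \<in> borel_measurable (vimage_algebra (space \<rho>) (r ^^ n) \<rho>)" "integrable \<rho> v"
  shows "\<exists>c. AE x in \<rho>. v x = c"
proof -
  have sp: "space \<rho> = UNIV" using sets_eq_imp_space_eq[OF \<rho>] by simp
  let ?G = "\<Inter>n\<in>{1..}. {(r ^^ n) -` A |A. A \<in> sets borel}"
  have rn: "(r ^^ n) \<in> \<rho> \<rightarrow>\<^sub>M \<rho>" for n by (rule measurable_compose_n) (rule r)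
  have "?G \<subseteq> sets borel"
  proof
    fix A assume "A \<in> ?G"
    then have "A \<in> {(r ^^ 1) -` A |A. A \<in> sets borel}" by blast
    then show "A \<in> sets borel" using measurable_sets[OF rn[of 1]] by (auto simp: \<rho> sp)
  qed
  then have "sigma_sets UNIV ?G \<subseteq> sets borel" using sets.sigma_sets_subset[of ?G borel] by simp
  then have sub: "subalgebra \<rho> (tail_algebra r)"
    by (simp add: subalgebra_def tail_algebra_def sp \<rho>)
  have "v \<in> borel_measurable (tail_algebra r)"
  proof (rule measurableI)
    fix S :: "real set" assume S: "S \<in> sets borel"
    have "v -` S \<in> {(r ^^ n) -` A |A. A \<in> sets borel}" for n
      using measurable_sets[OF v(1)[of n] S] by (auto simp: sets_vimage_algebra2 sp \<rho>)
    then have "v -` S \<in> ?G" by blast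
    then show "v -` S \<inter> space (tail_algebra r) \<in> sets (tail_algebra r)"
      by (simp add: tail_algebra_def sigma_sets.Basic)
  qed simp
  then have "integrable (restr_to_subalg \<rho> (tail_algebra r)) (\<lambda>x. complex_of_real (v x))"
    using v(2) by (intro integrable_in_subalg[OF sub]) auto
  then obtain c where "AE x in \<rho>. complex_of_real (v x) = c"
    using avg unfolding averaging_def by blast
  then have "AE x in \<rho>. v x = Re c" by eventually_elim auto
  then show ?thesis by blast
qed

theorem theorem3p9:
  fixes r :: "'a::metric_space \<Rightarrow> 'a"
    and \<rho> :: "'a measure"
    and m0 :: "'a \<Rightarrow> complex"
    and h :: "'a \<Rightarrow> real"
  assumes compact_X: "compact (UNIV :: 'a set)"
    and r_measurable: "r \<in> borel \<rightarrow>\<^sub>M borel"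
    and r_onto: "surj r"
    and r_noninvertible: "\<not> bij r"
    and r_fibres: "\<And>x. finite (r -` {x}) \<and> 0 < card (r -` {x})"
    and rho_borel: "sets \<rho> = sets borel"
    and rho_prob: "prob_space \<rho>"
    and rho_invariant: "strongly_invariant \<rho> r"
    and m0_bounded: "m0 \<in> L_infinity \<rho>"
    and m0_normalized: "AE x in \<rho>. fibre_avg r (\<lambda>y. (norm (m0 y))\<^sup>2) x = 1"
    and h_bounded: "h \<in> L_infinity \<rho>"
    and h_nonneg: "AE x in \<rho>. 0 \<le> h x"
    and h_harmonic: "AE x in \<rho>. fibre_avg r (\<lambda>y. (norm (m0 y))\<^sup>2 * h y) x = h x"
  shows "(\<forall>f\<in>L2_fun (weighted_measure \<rho> h).
            (\<lambda>x. m0 x * f (r x)) \<in> L2_fun (weighted_measure \<rho> h) \<and>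
            S0 (weighted_measure \<rho> h) m0 r (L2_class (weighted_measure \<rho> h) f) =
              L2_class (weighted_measure \<rho> h) (\<lambda>x. m0 x * f (r x))) \<and>
         linear_isometry_L2 (weighted_measure \<rho> h) (S0 (weighted_measure \<rho> h) m0 r) \<and>
         (averaging \<rho> r \<and> 0 < measure \<rho> {x. norm (m0 x) \<noteq> 1} \<longrightarrow>
            (\<Inter>k\<in>{1..}. (S0 (weighted_measure \<rho> h) m0 r ^^ k) ` L2_space (weighted_measure \<rho> h)) =
              {L2_zero (weighted_measure \<rho> h)})"
proof -
  interpret prob_space \<rho> by (rule rho_prob)
  have sp: "space \<rho> = UNIV" using sets_eq_imp_space_eq[OF rho_borel] by simp
  have r: "r \<in> \<rho> \<rightarrow>\<^sub>M \<rho>"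
    using r_measurable measurable_cong_sets[OF rho_borel rho_borel] by simp
  have [measurable]: "m0 \<in> borel_measurable \<rho>" "h \<in> borel_measurable \<rho>"
    using m0_bounded h_bounded by (auto simp: L_infinity_def)
  obtain Bm Bh where Bm: "AE x in \<rho>. norm (m0 x) \<le> Bm" and Bh: "AE x in \<rho>. norm (h x) \<le> Bh"
    using m0_bounded h_bounded by (auto simp: L_infinity_def)
  \<comment> \<open>Applied to three weights: 1 gives invariance, \<open>|m0|^2 h\<close>
    harmonicity, and \<open>|m0|^2\<close> the normalization.\<close>
  note transfer = strongly_invariant_nn_integral[OF rho_prob r rho_invariant]
  have m_sq: "(\<lambda>x. (norm (m0 x))\<^sup>2) \<in> L_infinity \<rho>"
    unfolding L_infinity_def
  proof (safe intro!: exI[of _ "Bm\<^sup>2"])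
    show "AE x in \<rho>. norm ((norm (m0 x))\<^sup>2) \<le> Bm\<^sup>2"
      using Bm by eventually_elim (auto intro: power_mono)
  qed measurable
  have mh: "(\<lambda>x. (norm (m0 x))\<^sup>2 * h x) \<in> L_infinity \<rho>"
    unfolding L_infinity_def
  proof (safe intro!: exI[of _ "Bm\<^sup>2 * Bh"])
    show "AE x in \<rho>. norm ((norm (m0 x))\<^sup>2 * h x) \<le> Bm\<^sup>2 * Bh"
      using Bm Bh by eventually_elim (auto simp: abs_mult intro!: mult_mono power_mono)
  qed measurable
  \<comment> \<open>Fibres are finite and nonempty; an infinite or empty one would have
    \<open>card\<close> 0 and average 0.\<close>
  have one: "fibre_avg r (\<lambda>_. 1::real) x = 1" for x
    using r_fibres[of x] by (auto simp: fibre_avg_def card_gt_0_iff)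
  have one_bounded: "(\<lambda>_. 1::real) \<in> L_infinity \<rho>" by (auto simp: L_infinity_def)
  \<comment> \<open>A version of h nonnegative at every point. As \<open>ennreal\<close> sends
    negative numbers to 0, the weighted measure is literally the same.\<close>
  define h' where "h' x = max 0 (h x)" for x
  have h'_eq: "ennreal (h' x) = ennreal (h x)" for x by (simp add: h'_def max_def ennreal_neg)
  have M_eq: "weighted_measure \<rho> h' = weighted_measure \<rho> h" by (simp add: h'_eq)
  interpret harmonic_weight \<rho> r m0 h'
  proof
    show "h' \<in> borel_measurable \<rho>" unfolding h'_def by measurable
    have "AE x in \<rho>. h' x \<le> max 0 Bh" using Bh by eventually_elim (auto simp: h'_def)
    then show "\<exists>B. AE x in \<rho>. h' x \<le> B" by blast
    fix \<phi> :: "'a \<Rightarrow> ennreal" assume \<phi>: "\<phi> \<in> borel_measurable \<rho>"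
    show "(\<integral>\<^sup>+x. \<phi> (r x) \<partial>\<rho>) = (\<integral>\<^sup>+x. \<phi> x \<partial>\<rho>)"
      using transfer[OF one_bounded _ _ _ _ \<phi>, of "\<lambda>_. 1"] one by simp
    have "AE x in \<rho>. 0 \<le> (norm (m0 x))\<^sup>2 * h x" using h_nonneg by eventually_elim simp
    then show "(\<integral>\<^sup>+x. ennreal ((norm (m0 x))\<^sup>2 * h' x) * \<phi> (r x) \<partial>\<rho>) = (\<integral>\<^sup>+x. ennreal (h' x) * \<phi> x \<partial>\<rho>)"
      using transfer[OF mh _ _ h_nonneg h_harmonic \<phi>] by (simp add: ennreal_mult' h'_eq)
  qed (auto simp: r h'_def)
  have normalized: "(\<integral>\<^sup>+x. ennreal ((norm (m0 x))\<^sup>2) * \<phi> (r x) \<partial>\<rho>) = (\<integral>\<^sup>+x. \<phi> x \<partial>\<rho>)"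
    if "\<phi> \<in> borel_measurable \<rho>" for \<phi> :: "'a \<Rightarrow> ennreal"
    using transfer[OF m_sq _ _ _ m0_normalized that] by simp
  have pure: "(\<Inter>k\<in>{1..}. (S0 M m0 r ^^ k) ` L2_space M) = {L2_zero M}"
    if avg: "averaging \<rho> r" and pos: "0 < measure \<rho> {x. norm (m0 x) \<noteq> 1}"
  proof -
    interpret exact_harmonic_weight \<rho> r m0 h'
      by standard (use averaging_imp_tail_trivial[OF avg rho_borel r] in \<open>simp add: F_def\<close>)
    have "\<not> (AE x in \<rho>. norm (m0 x) = 1)"
    proof
      assume "AE x in \<rho>. norm (m0 x) = 1"
      moreover have "{x \<in> space \<rho>. norm (m0 x) \<noteq> 1} \<in> sets \<rho>" by measurable
      ultimately have "measure \<rho> {x. norm (m0 x) \<noteq> 1} = measure \<rho> {}"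
        using sp by (intro measure_eq_AE) auto
      with pos show False by simp
    qed
    from S0_pure[OF normalized this] show ?thesis .
  qed
  have classes: "(\<lambda>x. m0 x * f (r x)) \<in> L2_fun M \<and>
      S0 M m0 r (L2_class M f) = L2_class M (\<lambda>x. m0 x * f (r x))" if "f \<in> L2_fun M" for f
    using T_L2[OF that] S0_class[OF that] by (simp add: T_def[abs_def])
  show ?thesis
    unfolding M_eq[symmetric]
  proof (intro conjI[OF _ conjI] ballI impI)
    show "linear_isometry_L2 M (S0 M m0 r)" by (rule S0_linear_isometry)
  next
    assume "averaging \<rho> r \<and> 0 < measure \<rho> {x. norm (m0 x) \<noteq> 1}"
    then show "(\<Inter>k\<in>{1..}. (S0 M m0 r ^^ k) ` L2_space M) = {L2_zero M}"
      using pure by simp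
  qed (rule classes)
qed

end
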